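(* Let $(\Omega_1,\Sigma_1,\mu)$ and $(\Omega_2,\Sigma_2,\nu)$ be $\sigma$-finite measure spaces, and let $f\in L_1(\mu\otimes\nu)$ with $f\geq0$. Then the following assertions are equivalent: (i) $f\in\mathrm{NA}_\pi(L_1(\mu)\widehat{\otimes}_\pi L_1(\nu))$. (ii) $f=\sum_{i=1}^\infty c_i(\chi_{A_i}\otimes\chi_{B_i})$ for some $(c_i)_{i=1}^\infty\subseteq[0,\infty)$ and some measurable rectangles $A_i\times B_i$ with $A_i\in\Sigma_1$, $B_i\in\Sigma_2$. (iii) For each $c\geq0$, the level set $\{(\omega,\gamma)\in\Omega_1\times\Omega_2: f(\omega,\gamma)>c\}$ coincides with a countable union of measurable rectangles, up to a $(\mu\otimes\nu)$-null set.
   Context: The scalar field of the $L_1$ spaces is $\mathbb K\in\{\mathbb R,\mathbb C\}$. $\mu\otimes\nu$ is the product measure, and the projective tensor product $L_1(\mu)\widehat{\otimes}_\pi L_1(\nu)$ is isometrically identified with $L_1(\mu\otimes\nu)$ via $(g\otimes h)(\omega,\gamma)=g(\omega)h(\gamma)$ (so $\chi_A\otimes\chi_B=\chi_{A\times B}$). An element $u\in X\widehat{\otimes}_\pi Y$ attains its projective norm if there are $(x_i)\subseteq X$, $(y_i)\subseteq Y$ with $u=\sum_{i=1}^\infty x_i\otimes y_i$ and $\|u\|_\pi=\sum_{i=1}^\infty\|x_i\|\|y_i\|$; $\mathrm{NA}_\pi(X\widehat{\otimes}_\pi Y)$ is the set of such elements. A measurable rectangle is a set $A\times B$ with $A\in\Sigma_1$,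 $B\in\Sigma_2$. *)

theory Defs
  imports "HOL-Analysis.Analysis"
begin

text \<open>
  The scalar field is a type \<open>'k\<close> of sort \<open>{real_normed_field, euclidean_space}\<close>. Both
  \<^typ>\<open>real\<close> and \<^typ>\<open>complex\<close> are instances, and by Frobenius' theorem every type of this
  sort is isomorphic to one of them.

  Elements of \<open>L\<^sub>1\<close> are represented by integrable functions; equality in \<open>L\<^sub>1\<close> is equality
  almost everywhere.
\<close>

definition L1_space :: "'a measure \<Rightarrow> ('a \<Rightarrow> 'k::{banach, second_countable_topology}) set"
  where "L1_space M = {g. integrable M g}"

definition L1_norm :: "'a measure \<Rightarrow> ('a \<Rightarrow> 'k::{banach, second_countable_topology}) \<Rightarrow> real"
  where "L1_norm M g = (\<integral>x. norm (g x) \<partial>M)"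

definition L1_sums ::
    "'a measure \<Rightarrow> (nat \<Rightarrow> 'a \<Rightarrow> 'k::{banach, second_countable_topology}) \<Rightarrow> ('a \<Rightarrow> 'k) \<Rightarrow> bool"
  where "L1_sums M u f \<longleftrightarrow>
    (\<forall>i. u i \<in> L1_space M) \<and> f \<in> L1_space M \<and>
    (\<lambda>n. L1_norm M (\<lambda>x. f x - (\<Sum>i<n. u i x))) \<longlonglongrightarrow> 0"

definition tensor :: "('a \<Rightarrow> 'k::times) \<Rightarrow> ('b \<Rightarrow> 'k) \<Rightarrow> 'a \<times> 'b \<Rightarrow> 'k"
  where "tensor g h = (\<lambda>(\<omega>, \<gamma>). g \<omega> * h \<gamma>)"

text \<open>
  A \<open>'k\<close>-bilinear form on \<open>L\<^sub>1(M) \<times> L\<^sub>1(N)\<close>. The first two conditions say that it is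
  well defined on classes modulo almost everywhere equality.
\<close>

definition L1_bilinear_form ::
    "'a measure \<Rightarrow> 'b measure \<Rightarrow>
     (('a \<Rightarrow> 'k::{real_normed_field, euclidean_space}) \<Rightarrow> ('b \<Rightarrow> 'k) \<Rightarrow> 'k) \<Rightarrow> bool"
  where "L1_bilinear_form M N \<beta> \<longleftrightarrow>
    (\<forall>g\<in>L1_space M. \<forall>g'\<in>L1_space M. \<forall>h\<in>L1_space N.
       (AE x in M. g x = g' x) \<longrightarrow> \<beta> g h = \<beta> g' h) \<and>
    (\<forall>g\<in>L1_space M. \<forall>h\<in>L1_space N. \<forall>h'\<in>L1_space N.
       (AE y in N. h y = h' y) \<longrightarrow> \<beta> g h = \<beta> g h') \<and>
    (\<forall>g\<in>L1_space M. \<forall>g'\<in>L1_space M. \<forall>h\<in>L1_space N.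
       \<beta> (\<lambda>x. g x + g' x) h = \<beta> g h + \<beta> g' h) \<and>
    (\<forall>g\<in>L1_space M. \<forall>h\<in>L1_space N. \<forall>h'\<in>L1_space N.
       \<beta> g (\<lambda>y. h y + h' y) = \<beta> g h + \<beta> g h') \<and>
    (\<forall>g\<in>L1_space M. \<forall>h\<in>L1_space N. \<forall>c.
       \<beta> (\<lambda>x. c * g x) h = c * \<beta> g h \<and> \<beta> g (\<lambda>y. c * h y) = c * \<beta> g h)"

text \<open>
  A list \<open>[(g\<^sub>1, h\<^sub>1), \<dots>, (g\<^sub>n, h\<^sub>n)]\<close> denotes the element
  \<open>g\<^sub>1 \<otimes> h\<^sub>1 + \<dots> + g\<^sub>n \<otimes> h\<^sub>n\<close> of the algebraic tensor product \<open>L\<^sub>1(M) \<otimes> L\<^sub>1(N)\<close>,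
  regarded as the functional \<open>\<beta> \<mapsto> \<Sum>i. \<beta> g\<^sub>i h\<^sub>i\<close> on the bilinear forms. Two lists denote the
  same tensor iff these functionals agree.
\<close>

definition same_tensor ::
    "'a measure \<Rightarrow> 'b measure \<Rightarrow>
     (('a \<Rightarrow> 'k::{real_normed_field, euclidean_space}) \<times> ('b \<Rightarrow> 'k)) list \<Rightarrow>
     (('a \<Rightarrow> 'k) \<times> ('b \<Rightarrow> 'k)) list \<Rightarrow> bool"
  where "same_tensor M N s t \<longleftrightarrow>
    (\<forall>\<beta>. L1_bilinear_form M N \<beta> \<longrightarrow> (\<Sum>(g, h)\<leftarrow>s. \<beta> g h) = (\<Sum>(g, h)\<leftarrow>t. \<beta> g h))"

definition proj_norm ::
    "'a measure \<Rightarrow> 'b measure \<Rightarrow>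
     (('a \<Rightarrow> 'k::{real_normed_field, euclidean_space}) \<times> ('b \<Rightarrow> 'k)) list \<Rightarrow> real"
  where "proj_norm M N s =
    Inf {\<Sum>(g, h)\<leftarrow>t. L1_norm M g * L1_norm N h | t.
           set t \<subseteq> L1_space M \<times> L1_space N \<and> same_tensor M N s t}"

text \<open>
  The projective tensor product is the completion of the algebraic tensor product with respect
  to \<^const>\<open>proj_norm\<close>. If \<open>\<Sum>i. \<parallel>g\<^sub>i\<parallel> \<parallel>h\<^sub>i\<parallel>\<close> converges, then the partial sums of
  \<open>\<Sum>i. g\<^sub>i \<otimes> h\<^sub>i\<close> form a Cauchy sequence for this norm. They define an element \<open>u\<close> of the
  completion, and \<open>\<parallel>u\<parallel>\<^sub>\<pi>\<close> is the limit of the projective norms of the partial sums. The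
  function on the product space identified with \<open>u\<close> is the \<open>L\<^sub>1\<close>-sum of the functions
  \<^term>\<open>tensor (g i) (h i)\<close>.
\<close>

definition NA_proj ::
    "'a measure \<Rightarrow> 'b measure \<Rightarrow> ('a \<times> 'b \<Rightarrow> 'k::{real_normed_field, euclidean_space}) set"
  where "NA_proj M N = {f. \<exists>g h.
    (\<forall>i. g i \<in> L1_space M) \<and> (\<forall>i. h i \<in> L1_space N) \<and>
    summable (\<lambda>i. L1_norm M (g i) * L1_norm N (h i)) \<and>
    L1_sums (M \<Otimes>\<^sub>M N) (\<lambda>i. tensor (g i) (h i)) f \<and>
    (\<lambda>n. proj_norm M N (map (\<lambda>i. (g i, h i)) [0..<n]))
      \<longlonglongrightarrow> (\<Sum>i. L1_norm M (g i) * L1_norm N (h i))}"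

end

theory Submission
  imports Defs
begin

text \<open>
  Because the projective norm is dominated by the \<open>L\<^sub>1\<close>-norm on the product, an optimal
  representation \<open>f = \<Sum>i. g\<^sub>i \<otimes> h\<^sub>i\<close> satisfies \<open>\<Sum>i. \<parallel>g\<^sub>i\<parallel> \<parallel>h\<^sub>i\<parallel> \<le> \<integral>f\<close>. Together with
  \<open>f \<le> \<Sum>i. |g\<^sub>i| \<otimes> |h\<^sub>i|\<close> this forces equality almost everywhere, and each \<open>|g\<^sub>i| \<otimes> |h\<^sub>i|\<close> is a
  countable sum of rectangles. Conversely, the bilinear form \<open>(g, h) \<mapsto> \<integral>g \<integral>h\<close> shows that
  nonnegative sums of rectangles are optimal representations.

  Level sets of \<open>\<Sum>i. c\<^sub>i \<chi>\<^bsub>A\<^sub>i\<times>B\<^sub>i\<^esub>\<close> are unions, over the finite index sets with \<open>\<Sum>c\<^sub>i > c\<close>, of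
  intersections of rectangles. Conversely, \<open>f\<close> is the supremum of \<open>r \<chi>\<^bsub>{f > r}\<^esub>\<close> over the
  nonnegative rationals \<open>r\<close>, that is, a countable supremum of multiples of rectangles.
\<close>

section \<open>Countable nonnegative combinations of rectangles\<close>

text \<open>With values in \<open>ennreal\<close> the series always exists and may be rearranged
  freely, so closure properties need no summability conditions. The coefficients stay real, hence
  finite.\<close>

definition rect_sum :: "'a measure \<Rightarrow> 'b measure \<Rightarrow> ('a \<times> 'b \<Rightarrow> ennreal) \<Rightarrow> bool"
  where "rect_sum M N F \<longleftrightarrow> (\<exists>(c :: nat \<Rightarrow> real) A B.
    (\<forall>i. 0 \<le> c i \<and> A i \<in> sets M \<and> B i \<in> sets N) \<and>
    (AE p in M \<Otimes>\<^sub>M N. F p = (\<Sum>i. ennreal (c i) * indicator (A i \<times> B i) p)))"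

lemma rect_sum_cong_AE:
  assumes "rect_sum M N F" "AE p in M \<Otimes>\<^sub>M N. F p = G p"
  shows "rect_sum M N G"
proof -
  obtain c A B where *: "\<forall>i. 0 \<le> c i \<and> A i \<in> sets M \<and> B i \<in> sets N"
    and F: "AE p in M \<Otimes>\<^sub>M N. F p = (\<Sum>i. ennreal (c i) * indicator (A i \<times> B i) p)"
    using assms(1) unfolding rect_sum_def by blast
  have "AE p in M \<Otimes>\<^sub>M N. G p = (\<Sum>i. ennreal (c i) * indicator (A i \<times> B i) p)"
    using F assms(2) by eventually_elim simp
  with * show ?thesis unfolding rect_sum_def by blast
qed

text \<open>A double series of nonnegative terms may be summed along any enumeration of the index
  pairs, here \<open>prod_decode\<close>. The exceptional null sets of the countably many
  \<open>F n\<close> unite to a null set.\<close>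

lemma rect_sum_suminf:
  assumes "\<And>n. rect_sum M N (F n)"
  shows "rect_sum M N (\<lambda>p. \<Sum>n. F n p)"
proof -
  have "\<forall>n. \<exists>(c :: nat \<Rightarrow> real) A B. (\<forall>i. 0 \<le> c i \<and> A i \<in> sets M \<and> B i \<in> sets N) \<and>
    (AE p in M \<Otimes>\<^sub>M N. F n p = (\<Sum>i. ennreal (c i) * indicator (A i \<times> B i) p))"
    using assms unfolding rect_sum_def by blast
  from choice[OF this] obtain c :: "nat \<Rightarrow> nat \<Rightarrow> real"
    where "\<forall>n. \<exists>A B. (\<forall>i. 0 \<le> c n i \<and> A i \<in> sets M \<and> B i \<in> sets N) \<and>
      (AE p in M \<Otimes>\<^sub>M N. F n p = (\<Sum>i. ennreal (c n i) * indicator (A i \<times> B i) p))" ..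
  from choice[OF this] obtain A
    where "\<forall>n. \<exists>B. (\<forall>i. 0 \<le> c n i \<and> A n i \<in> sets M \<and> B i \<in> sets N) \<and>
      (AE p in M \<Otimes>\<^sub>M N. F n p = (\<Sum>i. ennreal (c n i) * indicator (A n i \<times> B i) p))" ..
  from choice[OF this] obtain B
    where "\<forall>n. (\<forall>i. 0 \<le> c n i \<and> A n i \<in> sets M \<and> B n i \<in> sets N) \<and>
      (AE p in M \<Otimes>\<^sub>M N. F n p = (\<Sum>i. ennreal (c n i) * indicator (A n i \<times> B n i) p))" ..
  then have *: "\<And>n i. 0 \<le> c n i \<and> A n i \<in> sets M \<and> B n i \<in> sets N"
    and F: "\<And>n. AE p in M \<Otimes>\<^sub>M N. F n p = (\<Sum>i. ennreal (c n i) * indicator (A n i \<times> B n i) p)"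
    by blast+
  define u where "u p = (\<lambda>(n, i). ennreal (c n i) * indicator (A n i \<times> B n i) p)" for p
  have "AE p in M \<Otimes>\<^sub>M N. \<forall>n. F n p = (\<Sum>i. u p (n, i))"
    unfolding AE_all_countable u_def using F by simp
  then have "AE p in M \<Otimes>\<^sub>M N. (\<Sum>n. F n p) = (\<Sum>i. u p (prod_decode i))"
  proof eventually_elim
    case (elim p)
    then have "(\<Sum>i. u p (prod_decode i)) = suminf (\<lambda>n. F n p)"
      by (intro suminf_ennreal_2dimen) simp
    then show ?case by simp
  qed
  then have "AE p in M \<Otimes>\<^sub>M N. (\<Sum>n. F n p) =
     (\<Sum>i. ennreal (case_prod c (prod_decode i)) *
       indicator (case_prod A (prod_decode i) \<times> case_prod B (prod_decode i)) p)"
    by (simp add: u_def split_beta)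
  moreover have "\<forall>i. 0 \<le> case_prod c (prod_decode i) \<and>
      case_prod A (prod_decode i) \<in> sets M \<and> case_prod B (prod_decode i) \<in> sets N"
    using * by (simp add: split_beta)
  ultimately show ?thesis
    unfolding rect_sum_def
    by (intro exI[of _ "\<lambda>i. case_prod c (prod_decode i)"] exI[of _ "\<lambda>i. case_prod A (prod_decode i)"]
        exI[of _ "\<lambda>i. case_prod B (prod_decode i)"] conjI)
qed

lemma rect_sum_rectangle:
  assumes "0 \<le> c" "A \<in> sets M" "B \<in> sets N"
  shows "rect_sum M N (\<lambda>p. ennreal c * indicator (A \<times> B) p)"
proof -
  have "(\<Sum>i. ennreal (if i = (0::nat) then c else 0) * indicator (A \<times> B) p)
      = ennreal c * indicator (A \<times> B) p" for p
    by (subst suminf_finite[of "{0}"]) auto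
  then show ?thesis
    unfolding rect_sum_def using assms
    by (intro exI[of _ "\<lambda>i. if i = 0 then c else 0"] exI[of _ "\<lambda>_. A"] exI[of _ "\<lambda>_. B"]) auto
qed

lemma rect_sum_add:
  assumes "rect_sum M N F" "rect_sum M N G"
  shows "rect_sum M N (\<lambda>p. F p + G p)"
proof -
  have 0: "rect_sum M N (\<lambda>p. 0)"
    using rect_sum_rectangle[of 0 "{}" M "{}" N] by simp
  have "rect_sum M N (\<lambda>p. \<Sum>n. if n = 0 then F p else if n = Suc 0 then G p else 0)"
  proof (rule rect_sum_suminf)
    fix n :: nat
    show "rect_sum M N (\<lambda>p. if n = 0 then F p else if n = Suc 0 then G p else 0)"
      using assms 0 by (cases "n = 0"; cases "n = Suc 0") auto
  qed
  moreover have "(\<Sum>n. if n = 0 then F p else if n = Suc 0 then G p else 0) = F p + G p" for p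
    by (subst suminf_finite[of "{0, Suc 0}"]) auto
  ultimately show ?thesis by simp
qed

lemma rect_sum_sum:
  assumes "finite I" "\<And>i. i \<in> I \<Longrightarrow> rect_sum M N (F i)"
  shows "rect_sum M N (\<lambda>p. \<Sum>i\<in>I. F i p)"
  using assms
proof (induction I rule: finite_induct)
  case empty
  show ?case using rect_sum_rectangle[of 0 "{}" M "{}" N] by simp
next
  case (insert x I)
  have "rect_sum M N (\<lambda>p. F x p + (\<Sum>i\<in>I. F i p))"
    using insert by (intro rect_sum_add) auto
  with insert.hyps show ?case by simp
qed

section \<open>Suprema of weighted rectangles, and products of functions\<close>

text \<open>The first \<open>n\<close> sides cut each factor into finitely many atoms,
  \<open>AJ S\<close> and \<open>BK T\<close>, according to which sides contain the point. On
  \<open>AJ S \<times> BK T\<close> the rectangles containing the point are exactly those indexed by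
  \<open>S \<inter> T\<close>, so the function is constant there with value
  \<open>\<phi> (S \<inter> T)\<close>.\<close>

lemma rect_sum_finite_pattern:
  assumes AB: "\<And>j. A j \<in> sets M" "\<And>j. B j \<in> sets N" and \<phi>: "\<And>S. 0 \<le> (\<phi> S :: real)"
  shows "rect_sum M N (\<lambda>p. ennreal (\<phi> {j. j < (n::nat) \<and> p \<in> A j \<times> B j}))"
proof -
  define J where "J x = {j. j < n \<and> x \<in> A j}" for x
  define K where "K y = {j. j < n \<and> y \<in> B j}" for y
  define P where "P = Pow {..<n}"
  define AJ where "AJ S = {x \<in> space M. \<forall>j<n. x \<in> A j \<longleftrightarrow> j \<in> S}" for S
  define BK where "BK S = {x \<in> space N. \<forall>j<n. x \<in> B j \<longleftrightarrow> j \<in> S}" for S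
  note AB[measurable]
  have meas: "AJ S \<in> sets M" "BK S \<in> sets N" for S
    unfolding AJ_def BK_def by measurable
  have AJ: "x \<in> AJ S \<longleftrightarrow> J x = S" if "x \<in> space M" "S \<in> P" for x S
    using that unfolding AJ_def J_def P_def set_eq_iff by blast
  have BK: "x \<in> BK S \<longleftrightarrow> K x = S" if "x \<in> space N" "S \<in> P" for x S
    using that unfolding BK_def K_def P_def set_eq_iff by blast
  have "rect_sum M N (\<lambda>p. \<Sum>ST\<in>P \<times> P. ennreal (\<phi> (fst ST \<inter> snd ST)) *
      indicator (AJ (fst ST) \<times> BK (snd ST)) p)"
    by (intro rect_sum_sum rect_sum_rectangle \<phi> meas) (simp add: P_def)
  moreover have "AE p in M \<Otimes>\<^sub>M N. (\<Sum>ST\<in>P \<times> P. ennreal (\<phi> (fst ST \<inter> snd ST)) *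
      indicator (AJ (fst ST) \<times> BK (snd ST)) p) = ennreal (\<phi> {j. j < n \<and> p \<in> A j \<times> B j})"
  proof (rule AE_I2)
    fix p assume "p \<in> space (M \<Otimes>\<^sub>M N)"
    then obtain x y where p: "p = (x, y)" "x \<in> space M" "y \<in> space N"
      by (auto simp: space_pair_measure)
    have JK: "J x \<inter> K y = {j. j < n \<and> p \<in> A j \<times> B j}"
      unfolding J_def K_def p by blast
    \<comment> \<open>The atoms are disjoint, so only the pair of patterns of \<open>x\<close> and
      \<open>y\<close> contributes.\<close>
    have "(\<Sum>ST\<in>P \<times> P. ennreal (\<phi> (fst ST \<inter> snd ST)) * indicator (AJ (fst ST) \<times> BK (snd ST)) p)
       = (\<Sum>ST\<in>P \<times> P. if ST = (J x, K y) then ennreal (\<phi> (J x \<inter> K y)) else 0)"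
      by (rule sum.cong) (auto simp: p AJ BK indicator_def)
    also have "\<dots> = ennreal (\<phi> (J x \<inter> K y))"
      by (subst sum.delta) (auto simp: P_def J_def K_def)
    finally show "(\<Sum>ST\<in>P \<times> P. ennreal (\<phi> (fst ST \<inter> snd ST)) *
      indicator (AJ (fst ST) \<times> BK (snd ST)) p) = ennreal (\<phi> {j. j < n \<and> p \<in> A j \<times> B j})" by (simp only: JK)
  qed
  ultimately show ?thesis by (rule rect_sum_cong_AE)
qed

text \<open>
  The increments of the partial maxima are nonnegative functions of the membership pattern of
  finitely many rectangles, hence finite sums of rectangles.
\<close>

lemma rect_sum_SUP:
  fixes q :: "nat \<Rightarrow> real"
  assumes q: "\<And>j. 0 \<le> q j" and AB: "\<And>j. A j \<in> sets M" "\<And>j. B j \<in> sets N"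
  shows "rect_sum M N (\<lambda>p. SUP j. ennreal (q j) * indicator (A j \<times> B j) p)"
proof -
  define D where "D n p = {j. j < (n::nat) \<and> p \<in> A j \<times> B j}" for n p
  \<comment> \<open>The inserted 0 gives the empty pattern the value 0, which is the supremum at a
    point outside all rectangles.\<close>
  define mx where "mx S = Max (insert 0 (q ` S))" for S
  \<comment> \<open>\<open>rect_sum_finite_pattern\<close> asks for nonnegativity on every set,
    including infinite ones, where \<open>Max\<close> is unspecified; hence the outer
    \<open>max 0\<close>. On the patterns that occur it changes nothing, by
    \<open>mono\<close>.\<close>
  define \<phi> where "\<phi> n S = max 0 (mx S - mx (S \<inter> {..<n}))" for n S
  have fin: "finite (D n p)" for n p by (simp add: D_def)
  have mono: "mx (D n p) \<le> mx (D (Suc n) p)" for n p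
    unfolding mx_def using fin by (intro Max_mono) (auto simp: D_def)
  have DS: "D (Suc n) p \<inter> {..<n} = D n p" for n p by (auto simp: D_def)
  have "rect_sum M N (\<lambda>p. \<Sum>n. ennreal (\<phi> n (D (Suc n) p)))"
    unfolding D_def by (intro rect_sum_suminf rect_sum_finite_pattern AB) (simp add: \<phi>_def)
  moreover have "(\<Sum>n. ennreal (\<phi> n (D (Suc n) p))) = (SUP j. ennreal (q j) * indicator (A j \<times> B j) p)" for p
  proof -
    have \<phi>': "\<phi> n (D (Suc n) p) = mx (D (Suc n) p) - mx (D n p)" for n
      using mono[of n p] by (simp add: \<phi>_def DS)
    have mx0: "mx (D 0 p) = 0" by (simp add: D_def mx_def)
    have "(\<Sum>i<n. ennreal (\<phi> i (D (Suc i) p))) = ennreal (mx (D n p))" for n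
      using sum_lessThan_telescope[of "\<lambda>i. mx (D i p)" n]
      by (subst sum_ennreal) (auto simp: \<phi>' mono mx0)
    then have "(\<Sum>n. ennreal (\<phi> n (D (Suc n) p))) = (SUP n. ennreal (mx (D n p)))"
      by (simp add: suminf_eq_SUP)
    also have "\<dots> = (SUP j. ennreal (q j) * indicator (A j \<times> B j) p)"
    proof (intro antisym SUP_least)
      fix n
      have "mx (D n p) \<in> insert 0 (q ` D n p)"
        unfolding mx_def using fin by (intro Max_in) auto
      then show "ennreal (mx (D n p)) \<le> (SUP j. ennreal (q j) * indicator (A j \<times> B j) p)"
      proof
        assume "mx (D n p) \<in> q ` D n p"
        then obtain j where "j \<in> D n p" "mx (D n p) = q j" by auto
        then show ?thesis by (intro SUP_upper2[of j]) (auto simp: D_def)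
      qed simp
    next
      fix j
      show "ennreal (q j) * indicator (A j \<times> B j) p \<le> (SUP n. ennreal (mx (D n p)))"
      proof (cases "p \<in> A j \<times> B j")
        case True
        \<comment> \<open>\<open>D n p\<close> holds only indices below \<open>n\<close>, so index
          \<open>j\<close> first counts at stage \<open>Suc j\<close>.\<close>
        have "q j \<le> mx (D (Suc j) p)"
          unfolding mx_def using fin True by (intro Max_ge) (auto simp: D_def)
        with True show ?thesis by (intro SUP_upper2[of "Suc j"]) (auto simp: ennreal_leI)
      qed simp
    qed
    finally show ?thesis .
  qed
  ultimately show ?thesis by simp
qed

text \<open>By density, \<open>x\<close> is the supremum of the nonnegative rationals below it. The
  factor 0 or 1 keeps the index set independent of \<open>x\<close>; when \<open>x\<close> is a
  function value, this factor becomes the indicator of a level set.\<close>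

lemma ennreal_eq_SUP_range:
  assumes "range r = \<rat> \<inter> {0..}" "0 \<le> x"
  shows "ennreal x = (SUP k::nat. ennreal (r k) * (if r k < x then 1 else 0))"
proof (intro antisym SUP_least)
  show "ennreal x \<le> (SUP k. ennreal (r k) * (if r k < x then 1 else 0))"
  proof (rule dense_le)
    fix z assume "z < ennreal x"
    then obtain w where w: "z = ennreal w" "0 \<le> w" "w < x"
      using \<open>0 \<le> x\<close> by (metis ennreal_cases ennreal_less_iff top_greatest leD)
    obtain t where t: "t \<in> \<rat>" "w < t" "t < x" using Rats_dense_in_real[OF w(3)] by auto
    then have "t \<in> range r" using assms w by auto
    then obtain k where "t = r k" by auto
    with t w show "z \<le> (SUP k. ennreal (r k) * (if r k < x then 1 else 0))"
      by (intro SUP_upper2[of k]) (auto simp: ennreal_leI)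
  qed
qed (auto simp: ennreal_leI)

lemma obtain_nonneg_rats:
  obtains r :: "nat \<Rightarrow> real" where "range r = \<rat> \<inter> {0..}"
proof
  show "range (from_nat_into (\<rat> \<inter> {0::real..})) = \<rat> \<inter> {0..}"
    by (rule range_from_nat_into) (auto intro: countable_rat exI[of _ 0])
qed

text \<open>Multiplication by a fixed element of \<open>ennreal\<close> commutes with suprema, so
  the product is an iterated supremum, which is then flattened by enumerating the pairs.\<close>

lemma ennreal_SUP_mult_SUP:
  fixes a b :: "nat \<Rightarrow> ennreal"
  shows "(SUP i. a i) * (SUP j. b j) = (SUP m. a (fst (prod_decode m)) * b (snd (prod_decode m)))"
proof -
  have "(SUP i. a i) * (SUP j. b j) = (SUP i. SUP j. a i * b j)"
    by (simp add: SUP_mult_left_ennreal SUP_mult_right_ennreal) (rule SUP_commute)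
  also have "\<dots> = (SUP m. a (fst (prod_decode m)) * b (snd (prod_decode m)))"
  proof (intro antisym SUP_least)
    fix i j show "a i * b j \<le> (SUP m. a (fst (prod_decode m)) * b (snd (prod_decode m)))"
      by (intro SUP_upper2[of "prod_encode (i, j)"]) auto
  next
    fix m show "a (fst (prod_decode m)) * b (snd (prod_decode m)) \<le> (SUP i. SUP j. a i * b j)"
      by (intro SUP_upper2[of "fst (prod_decode m)"] SUP_upper2[of "snd (prod_decode m)"]) auto
  qed
  finally show ?thesis .
qed

text \<open>Each factor is the supremum of \<open>r k\<close> times the indicator of its level set
  above \<open>r k\<close>. Multiplying the two suprema gives a countable supremum of multiples of
  rectangles whose sides are level sets of \<open>u\<close> and \<open>v\<close>, so
  \<open>rect_sum_SUP\<close> applies.\<close>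

lemma rect_sum_product:
  assumes [measurable]: "u \<in> borel_measurable M" "v \<in> borel_measurable N"
    and nonneg: "\<And>x. 0 \<le> (u x :: real)" "\<And>y. 0 \<le> (v y :: real)"
  shows "rect_sum M N (\<lambda>p. ennreal (u (fst p) * v (snd p)))"
proof -
  obtain r :: "nat \<Rightarrow> real" where r: "range r = \<rat> \<inter> {0..}" by (rule obtain_nonneg_rats)
  then have r0: "0 \<le> r k" for k by (metis IntD2 atLeast_iff rangeI)
  define A where "A m = {x \<in> space M. r (fst (prod_decode m)) < u x}" for m
  define B where "B m = {y \<in> space N. r (snd (prod_decode m)) < v y}" for m
  define q where "q m = r (fst (prod_decode m)) * r (snd (prod_decode m))" for m
  have "rect_sum M N (\<lambda>p. SUP m. ennreal (q m) * indicator (A m \<times> B m) p)"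
    by (rule rect_sum_SUP) (auto simp: q_def r0 A_def B_def)
  moreover have "AE p in M \<Otimes>\<^sub>M N. (SUP m. ennreal (q m) * indicator (A m \<times> B m) p) =
      ennreal (u (fst p) * v (snd p))"
  proof (rule AE_I2)
    fix p assume "p \<in> space (M \<Otimes>\<^sub>M N)"
    then obtain x y where p: "p = (x, y)" "x \<in> space M" "y \<in> space N"
      by (auto simp: space_pair_measure)
    have "ennreal (u x * v y) = (SUP k. ennreal (r k) * (if r k < u x then 1 else 0)) *
        (SUP k. ennreal (r k) * (if r k < v y then 1 else 0))"
      by (simp add: ennreal_mult nonneg flip: ennreal_eq_SUP_range[OF r])
    also have "\<dots> = (SUP m. ennreal (q m) * indicator (A m \<times> B m) p)"
      unfolding ennreal_SUP_mult_SUP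
      by (intro SUP_cong refl) (auto simp: q_def p A_def B_def ennreal_mult r0 indicator_def)
    finally show "(SUP m. ennreal (q m) * indicator (A m \<times> B m) p) =
      ennreal (u (fst p) * v (snd p))" by (simp add: p)
  qed
  ultimately show ?thesis by (rule rect_sum_cong_AE)
qed

section \<open>Level sets as countable unions of rectangles\<close>

text \<open>A nonnegative series exceeds \<open>c\<close> iff some finite subfamily of its terms
  does. So the level set is the union, over the finite index sets with coefficient sum above
  \<open>c\<close>, of the intersections of their rectangles; \<open>set_decode\<close> enumerates
  the finite sets of naturals.\<close>

lemma rect_sum_level_set:
  fixes c :: real
  assumes F: "rect_sum M N F" and "0 \<le> c"
  shows "\<exists>(A :: nat \<Rightarrow> _) B. (\<forall>i. A i \<in> sets M \<and> B i \<in> sets N) \<and>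
    (AE p in M \<Otimes>\<^sub>M N. ennreal c < F p \<longleftrightarrow> p \<in> (\<Union>i. A i \<times> B i))"
proof -
  obtain a A B where *: "\<And>i. 0 \<le> (a i :: real)" "\<And>i. A i \<in> sets M" "\<And>i. B i \<in> sets N"
    and F: "AE p in M \<Otimes>\<^sub>M N. F p = (\<Sum>i. ennreal (a i) * indicator (A i \<times> B i) p)"
    using F unfolding rect_sum_def by blast
  define big where "big k \<longleftrightarrow> c < sum a (set_decode k)" for k
  define A' where "A' k = (if big k then \<Inter>i\<in>set_decode k. A i else {})" for k
  define B' where "B' k = (if big k then \<Inter>i\<in>set_decode k. B i else {})" for k
  \<comment> \<open>An empty intersection would be the whole type, which need not be a measurable
    set. Since \<open>c\<close> is nonnegative, the empty index set is never
    \<open>big\<close>.\<close>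
  have ne: "set_decode k \<noteq> {}" if "big k" for k
    using that \<open>0 \<le> c\<close> unfolding big_def by (metis sum.empty leD)
  have "A' k \<in> sets M \<and> B' k \<in> sets N" for k
    using * ne unfolding A'_def B'_def by (auto intro!: sets.finite_INT)
  moreover have "ennreal c < (\<Sum>i. ennreal (a i) * indicator (A i \<times> B i) p) \<longleftrightarrow> p \<in> (\<Union>k. A' k \<times> B' k)" for p
  proof -
    have eq: "(\<Sum>i\<in>S. ennreal (a i) * indicator (A i \<times> B i) p) =
        ennreal (\<Sum>i\<in>{i\<in>S. p \<in> A i \<times> B i}. a i)" if "finite S" for S
    proof -
      have "(\<Sum>i\<in>S. ennreal (a i) * indicator (A i \<times> B i) p) =
          (\<Sum>i\<in>{i\<in>S. p \<in> A i \<times> B i}. ennreal (a i))"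
        using that by (intro sum.mono_neutral_cong_right) (auto simp: indicator_def)
      also have "\<dots> = ennreal (\<Sum>i\<in>{i\<in>S. p \<in> A i \<times> B i}. a i)"
        using * by (intro sum_ennreal) auto
      finally show ?thesis .
    qed
    show ?thesis
    proof
      assume "ennreal c < (\<Sum>i. ennreal (a i) * indicator (A i \<times> B i) p)"
      then obtain n where "ennreal c < (\<Sum>i<n. ennreal (a i) * indicator (A i \<times> B i) p)"
        by (auto simp: suminf_eq_SUP less_SUP_iff)
      then have "c < (\<Sum>i\<in>{i\<in>{..<n}. p \<in> A i \<times> B i}. a i)"
        using \<open>0 \<le> c\<close> by (simp only: eq finite_lessThan ennreal_less_iff)
      \<comment> \<open>The index set that witnesses membership consists of those
        \<open>i < n\<close> whose rectangle contains \<open>p\<close>.\<close>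
      then have "p \<in> A' k \<times> B' k" if "k = set_encode {i\<in>{..<n}. p \<in> A i \<times> B i}" for k
        by (auto simp: A'_def B'_def big_def that mem_Times_iff)
      then show "p \<in> (\<Union>k. A' k \<times> B' k)" by blast
    next
      assume "p \<in> (\<Union>k. A' k \<times> B' k)"
      then obtain k where k: "big k" "\<And>i. i \<in> set_decode k \<Longrightarrow> p \<in> A i \<times> B i"
        by (auto simp: A'_def B'_def mem_Times_iff split: if_splits)
      have "ennreal c < ennreal (sum a (set_decode k))"
        using k(1) \<open>0 \<le> c\<close> by (simp add: big_def ennreal_less_iff)
      also have "sum a (set_decode k) = (\<Sum>i\<in>{i\<in>set_decode k. p \<in> A i \<times> B i}. a i)"
        using k(2) by (intro sum.cong) auto
      also have "ennreal \<dots> = (\<Sum>i\<in>set_decode k. ennreal (a i) * indicator (A i \<times> B i) p)"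
        by (simp only: eq finite_set_decode)
      also have "\<dots> \<le> (\<Sum>i. ennreal (a i) * indicator (A i \<times> B i) p)"
        by (rule sum_le_suminf) auto
      finally show "ennreal c < (\<Sum>i. ennreal (a i) * indicator (A i \<times> B i) p)" .
    qed
  qed
  ultimately show ?thesis
    using F by (intro exI[of _ A'] exI[of _ B']) (auto elim!: eventually_mono)
qed

text \<open>Almost everywhere \<open>f\<close> is the supremum of \<open>r\<close> times the
  indicator of \<open>{f > r}\<close> over nonnegative rationals \<open>r\<close>. Only countably
  many levels occur, so all of them can be replaced by their unions of rectangles off one null set;
  the pairs (level, rectangle) then index a single supremum for \<open>rect_sum_SUP\<close>.\<close>

lemma rect_sum_of_level_sets:
  fixes f :: "'a \<times> 'b \<Rightarrow> real"
  assumes nonneg: "AE p in M \<Otimes>\<^sub>M N. 0 \<le> f p"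
    and level: "\<And>c. 0 \<le> c \<Longrightarrow> \<exists>(A :: nat \<Rightarrow> _) B. (\<forall>i. A i \<in> sets M \<and> B i \<in> sets N) \<and>
      (AE p in M \<Otimes>\<^sub>M N. c < f p \<longleftrightarrow> p \<in> (\<Union>i. A i \<times> B i))"
  shows "rect_sum M N (\<lambda>p. ennreal (f p))"
proof -
  obtain r :: "nat \<Rightarrow> real" where r: "range r = \<rat> \<inter> {0..}" by (rule obtain_nonneg_rats)
  then have r0: "0 \<le> r k" for k by (metis IntD2 atLeast_iff rangeI)
  have "\<forall>k. \<exists>(A :: nat \<Rightarrow> _) B. (\<forall>i. A i \<in> sets M \<and> B i \<in> sets N) \<and>
      (AE p in M \<Otimes>\<^sub>M N. r k < f p \<longleftrightarrow> p \<in> (\<Union>i. A i \<times> B i))"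
    using level r0 by blast
  from choice[OF this] obtain A :: "nat \<Rightarrow> nat \<Rightarrow> _"
    where "\<forall>k. \<exists>B. (\<forall>i. A k i \<in> sets M \<and> B i \<in> sets N) \<and>
      (AE p in M \<Otimes>\<^sub>M N. r k < f p \<longleftrightarrow> p \<in> (\<Union>i. A k i \<times> B i))" ..
  from choice[OF this] obtain B
    where "\<forall>k. (\<forall>i. A k i \<in> sets M \<and> B k i \<in> sets N) \<and>
      (AE p in M \<Otimes>\<^sub>M N. r k < f p \<longleftrightarrow> p \<in> (\<Union>i. A k i \<times> B k i))" ..
  then have AB: "\<And>k i. A k i \<in> sets M" "\<And>k i. B k i \<in> sets N"
    and lev: "\<And>k. AE p in M \<Otimes>\<^sub>M N. r k < f p \<longleftrightarrow> p \<in> (\<Union>i. A k i \<times> B k i)"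
    by blast+
  define R where "R m = case_prod A (prod_decode m) \<times> case_prod B (prod_decode m)" for m
  have "rect_sum M N (\<lambda>p. SUP m. ennreal (r (fst (prod_decode m))) * indicator (R m) p)"
    unfolding R_def by (rule rect_sum_SUP) (auto simp: r0 AB split_beta)
  moreover have "AE p in M \<Otimes>\<^sub>M N. \<forall>k. r k < f p \<longleftrightarrow> p \<in> (\<Union>i. A k i \<times> B k i)"
    unfolding AE_all_countable using lev by simp
  then have "AE p in M \<Otimes>\<^sub>M N.
      (SUP m. ennreal (r (fst (prod_decode m))) * indicator (R m) p) = ennreal (f p)"
    using nonneg
  proof eventually_elim
    case (elim p)
    have "(SUP m. ennreal (r (fst (prod_decode m))) * indicator (R m) p) =
        (SUP k. ennreal (r k) * (if r k < f p then 1 else 0))"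
    proof (intro antisym SUP_least)
      fix m
      show "ennreal (r (fst (prod_decode m))) * indicator (R m) p \<le>
        (SUP k. ennreal (r k) * (if r k < f p then 1 else 0))"
        using elim(1)[rule_format, of "fst (prod_decode m)"]
        by (intro SUP_upper2[of "fst (prod_decode m)"]) (auto simp: R_def split_beta indicator_def)
    next
      fix k
      show "ennreal (r k) * (if r k < f p then 1 else 0) \<le>
        (SUP m. ennreal (r (fst (prod_decode m))) * indicator (R m) p)"
      proof (cases "r k < f p")
        case True
        then obtain i where "p \<in> A k i \<times> B k i" using elim(1) by blast
        then show ?thesis
          by (intro SUP_upper2[of "prod_encode (k, i)"]) (auto simp: R_def)
      qed simp
    qed
    also have "\<dots> = ennreal (f p)" using ennreal_eq_SUP_range[OF r elim(2)] by simp
    finally show ?case .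
  qed
  ultimately show ?thesis by (rule rect_sum_cong_AE)
qed

section \<open>Tensors and rectangle sums in the space of integrable functions\<close>

lemma L1_norm_nonneg: "0 \<le> L1_norm M g"
  by (simp add: L1_norm_def)

context pair_sigma_finite
begin

text \<open>The norm of the scalar field is multiplicative, so the iterated integral of the norm
  factorises and Fubini applies.\<close>

lemma integrable_tensor:
  fixes u :: "'a \<Rightarrow> 'k::{real_normed_field, euclidean_space}"
  assumes u[measurable]: "integrable M1 u" and v[measurable]: "integrable M2 v"
  shows "integrable (M1 \<Otimes>\<^sub>M M2) (tensor u v)"
    and "L1_norm (M1 \<Otimes>\<^sub>M M2) (tensor u v) = L1_norm M1 u * L1_norm M2 v"
proof -
  show *: "integrable (M1 \<Otimes>\<^sub>M M2) (tensor u v)"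
  proof (rule Fubini_integrable)
    show "integrable M1 (\<lambda>x. \<integral>y. norm (tensor u v (x, y)) \<partial>M2)"
      using u by (simp add: tensor_def norm_mult)
    show "AE x in M1. integrable M2 (\<lambda>y. tensor u v (x, y))"
      using v by (simp add: tensor_def)
    show "tensor u v \<in> borel_measurable (M1 \<Otimes>\<^sub>M M2)"
      unfolding tensor_def by measurable
  qed
  have "L1_norm (M1 \<Otimes>\<^sub>M M2) (tensor u v) = (\<integral>x. \<integral>y. norm (tensor u v (x, y)) \<partial>M2 \<partial>M1)"
    unfolding L1_norm_def by (rule integral_fst'[symmetric]) (rule integrable_norm[OF *])
  then show "L1_norm (M1 \<Otimes>\<^sub>M M2) (tensor u v) = L1_norm M1 u * L1_norm M2 v"
    by (simp add: tensor_def norm_mult L1_norm_def)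
qed

text \<open>Convergence in mean gives almost everywhere convergence along a subsequence of the
  partial sums. The terms are nonnegative, so the full series converges in \<open>ennreal\<close>
  and has the same limit as the subsequence.\<close>

lemma L1_sums_imp_rect_sum:
  fixes f :: "'a \<times> 'b \<Rightarrow> real"
  assumes c: "\<And>i. 0 \<le> c i \<and> A i \<in> sets M1 \<and> B i \<in> sets M2"
    and sums: "L1_sums (M1 \<Otimes>\<^sub>M M2)
      (\<lambda>i p. c i * tensor (indicator (A i)) (indicator (B i)) p) f"
  shows "rect_sum M1 M2 (\<lambda>p. ennreal (f p))"
proof -
  define u where "u i p = c i * tensor (indicator (A i)) (indicator (B i)) p" for i p
  have u: "u i p = c i * indicator (A i \<times> B i) p" for i p
    by (cases p) (simp add: u_def tensor_def indicator_times)
  have u0: "0 \<le> u i p" for i p using c by (simp add: u)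
  have sums': "L1_sums (M1 \<Otimes>\<^sub>M M2) u f"
    using sums by (simp only: u_def[abs_def])
  have int: "\<And>i. integrable (M1 \<Otimes>\<^sub>M M2) (u i)" "integrable (M1 \<Otimes>\<^sub>M M2) f"
    and lim: "(\<lambda>n. L1_norm (M1 \<Otimes>\<^sub>M M2) (\<lambda>p. f p - (\<Sum>i<n. u i p))) \<longlonglongrightarrow> 0"
    using sums' by (simp_all add: L1_sums_def L1_space_def)
  obtain r where r: "strict_mono r"
    and ae: "AE p in M1 \<Otimes>\<^sub>M M2. (\<lambda>n. f p - (\<Sum>i<r n. u i p)) \<longlonglongrightarrow> 0"
    using tendsto_L1_AE_subseq[OF _ lim[unfolded L1_norm_def]] int by auto
  have "AE p in M1 \<Otimes>\<^sub>M M2. ennreal (f p) = (\<Sum>i. ennreal (c i) * indicator (A i \<times> B i) p)"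
    using ae
  proof eventually_elim
    case (elim p)
    have "(\<lambda>n. f p - (f p - (\<Sum>i<r n. u i p))) \<longlonglongrightarrow> f p - 0"
      by (intro tendsto_intros elim)
    then have "(\<lambda>n. ennreal (\<Sum>i<r n. u i p)) \<longlonglongrightarrow> ennreal (f p)"
      by (intro tendsto_ennrealI) simp
    then have 1: "(\<lambda>n. \<Sum>i<r n. ennreal (u i p)) \<longlonglongrightarrow> ennreal (f p)"
      by (simp add: sum_ennreal u0)
    have "(\<lambda>n. \<Sum>i<n. ennreal (u i p)) \<longlonglongrightarrow> (\<Sum>i. ennreal (u i p))"
      by (rule summable_LIMSEQ) simp
    from LIMSEQ_subseq_LIMSEQ[OF this r]
    have "(\<lambda>n. \<Sum>i<r n. ennreal (u i p)) \<longlonglongrightarrow> (\<Sum>i. ennreal (u i p))"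
      by (simp add: o_def)
    with 1 have "ennreal (f p) = (\<Sum>i. ennreal (u i p))" by (rule LIMSEQ_unique)
    also have "\<dots> = (\<Sum>i. ennreal (c i) * indicator (A i \<times> B i) p)"
      by (intro suminf_cong) (simp add: u indicator_def)
    finally show ?case .
  qed
  then show ?thesis using c unfolding rect_sum_def by blast
qed

text \<open>The terms are nonnegative and sum to \<open>f\<close> almost everywhere, so the partial
  sums and the remainders all lie between 0 and \<open>f\<close>. Dominated convergence with bound
  \<open>f\<close> turns pointwise convergence into convergence in mean.\<close>

lemma rect_sum_imp_L1_sums:
  fixes f :: "'a \<times> 'b \<Rightarrow> real"
  assumes f[measurable]: "integrable (M1 \<Otimes>\<^sub>M M2) f" and nonneg: "AE p in M1 \<Otimes>\<^sub>M M2. 0 \<le> f p"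
    and "rect_sum M1 M2 (\<lambda>p. ennreal (f p))"
  shows "\<exists>(c :: nat \<Rightarrow> real) A B. (\<forall>i. 0 \<le> c i \<and> A i \<in> sets M1 \<and> B i \<in> sets M2) \<and>
    L1_sums (M1 \<Otimes>\<^sub>M M2) (\<lambda>i p. c i * tensor (indicator (A i)) (indicator (B i)) p) f"
proof -
  obtain c :: "nat \<Rightarrow> real" and A B where c: "\<And>i. 0 \<le> c i" and AB: "\<And>i. A i \<in> sets M1" "\<And>i. B i \<in> sets M2"
    and F: "AE p in M1 \<Otimes>\<^sub>M M2. ennreal (f p) = (\<Sum>i. ennreal (c i) * indicator (A i \<times> B i) p)"
    using assms(3) unfolding rect_sum_def by blast
  define u where "u i p = c i * tensor (indicator (A i)) (indicator (B i)) p" for i p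
  have u: "u i p = c i * indicator (A i \<times> B i) p" for i p
    by (cases p) (simp add: u_def tensor_def indicator_times)
  have u0: "0 \<le> u i p" for i p using c by (simp add: u)
  have [measurable]: "u i \<in> borel_measurable (M1 \<Otimes>\<^sub>M M2)" for i
    using AB unfolding u by measurable
  have sums: "AE p in M1 \<Otimes>\<^sub>M M2. (\<lambda>i. u i p) sums f p"
    using F nonneg
  proof eventually_elim
    case (elim p)
    have "(\<Sum>i. ennreal (u i p)) = ennreal (f p)"
      unfolding elim(1) by (intro suminf_cong) (simp add: u indicator_def)
    then have "(\<lambda>i. ennreal (u i p)) sums ennreal (f p)"
      by (metis summableI summable_sums)
    then show ?case using elim(2) u0 by (simp add: sums_ennreal)
  qed
  have le: "AE p in M1 \<Otimes>\<^sub>M M2. \<forall>n. (\<Sum>i<n. u i p) \<le> f p"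
    using sums
  proof eventually_elim
    case (elim p)
    then show ?case
      using sum_le_suminf[of "\<lambda>i. u i p"] u0 by (simp add: sums_iff)
  qed
  have int: "integrable (M1 \<Otimes>\<^sub>M M2) (u i)" for i
  proof (rule Bochner_Integration.integrable_bound[OF f])
    show "AE p in M1 \<Otimes>\<^sub>M M2. norm (u i p) \<le> norm (f p)"
      using le
    proof eventually_elim
      case (elim p)
      \<comment> \<open>The upper limit is the outer \<open>i\<close>. Splitting the partial sum at
        \<open>Suc i\<close> into this sum and the term \<open>u i p\<close> bounds that term by
        \<open>f p\<close>.\<close>
      have "0 \<le> (\<Sum>i<i. u i p)" by (intro sum_nonneg u0)
      with elim[rule_format, of "Suc i"] u0[of i p] show ?case by simp
    qed
  qed simp
  have "(\<lambda>n. \<integral>p. norm (f p - (\<Sum>i<n. u i p)) \<partial>(M1 \<Otimes>\<^sub>M M2)) \<longlonglongrightarrow> (\<integral>p. 0 \<partial>(M1 \<Otimes>\<^sub>M M2))"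
  proof (rule integral_dominated_convergence)
    show "AE p in M1 \<Otimes>\<^sub>M M2. (\<lambda>n. norm (f p - (\<Sum>i<n. u i p))) \<longlonglongrightarrow> 0"
      using sums
    proof eventually_elim
      case (elim p)
      then have "(\<lambda>n. norm (f p - (\<Sum>i<n. u i p))) \<longlonglongrightarrow> norm (f p - f p)"
        unfolding sums_def by (intro tendsto_intros)
      then show ?case by simp
    qed
    show "AE p in M1 \<Otimes>\<^sub>M M2. norm (norm (f p - (\<Sum>i<n. u i p))) \<le> f p" for n
      using le
    proof eventually_elim
      case (elim p)
      have "0 \<le> (\<Sum>i<n. u i p)" by (intro sum_nonneg u0)
      with elim[rule_format, of n] show ?case by simp
    qed
  qed (use f in measurable)
  then have "L1_sums (M1 \<Otimes>\<^sub>M M2) u f"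
    using f int by (simp add: L1_sums_def L1_space_def L1_norm_def)
  then show ?thesis using c AB unfolding u_def by blast
qed

lemma rect_sum_iff_level_sets:
  fixes f :: "'a \<times> 'b \<Rightarrow> real"
  assumes [measurable]: "f \<in> borel_measurable (M1 \<Otimes>\<^sub>M M2)" and nonneg: "AE p in M1 \<Otimes>\<^sub>M M2. 0 \<le> f p"
  shows "rect_sum M1 M2 (\<lambda>p. ennreal (f p)) \<longleftrightarrow>
    (\<forall>c\<ge>0. \<exists>(A :: nat \<Rightarrow> 'a set) B. (\<forall>i. A i \<in> sets M1 \<and> B i \<in> sets M2) \<and>
      sym_diff {p \<in> space M1 \<times> space M2. f p > c} (\<Union>i. A i \<times> B i) \<in> null_sets (M1 \<Otimes>\<^sub>M M2))"
proof -
  \<comment> \<open>Both sets are measurable, so a null symmetric difference is the same as almost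
    everywhere equivalence of membership.\<close>
  have *: "sym_diff {p \<in> space M1 \<times> space M2. f p > c} (\<Union>i. A i \<times> B i) \<in> null_sets (M1 \<Otimes>\<^sub>M M2) \<longleftrightarrow>
      (AE p in M1 \<Otimes>\<^sub>M M2. c < f p \<longleftrightarrow> p \<in> (\<Union>i. A i \<times> B i))"
    if AB: "\<forall>i. A i \<in> sets M1 \<and> B i \<in> sets M2" for c and A :: "nat \<Rightarrow> 'a set" and B
  proof -
    let ?S = "{p \<in> space M1 \<times> space M2. f p > c}" and ?U = "\<Union>i. A i \<times> B i"
    have "{p \<in> space (M1 \<Otimes>\<^sub>M M2). f p > c} \<in> sets (M1 \<Otimes>\<^sub>M M2)" by measurable
    then have "?S \<in> sets (M1 \<Otimes>\<^sub>M M2)" by (simp add: space_pair_measure)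
    moreover have "?U \<in> sets (M1 \<Otimes>\<^sub>M M2)" using AB by auto
    ultimately have "sym_diff ?S ?U \<in> sets (M1 \<Otimes>\<^sub>M M2)" by blast
    then have "sym_diff ?S ?U \<in> null_sets (M1 \<Otimes>\<^sub>M M2) \<longleftrightarrow> (AE p in M1 \<Otimes>\<^sub>M M2. p \<notin> sym_diff ?S ?U)"
      by (rule AE_iff_null_sets)
    also have "\<dots> \<longleftrightarrow> (AE p in M1 \<Otimes>\<^sub>M M2. c < f p \<longleftrightarrow> p \<in> ?U)"
      by (intro AE_cong) (auto simp: space_pair_measure)
    finally show ?thesis .
  qed
  show ?thesis
  proof
    assume F: "rect_sum M1 M2 (\<lambda>p. ennreal (f p))"
    show "\<forall>c\<ge>0. \<exists>(A :: nat \<Rightarrow> 'a set) B. (\<forall>i. A i \<in> sets M1 \<and> B i \<in> sets M2) \<and>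
      sym_diff {p \<in> space M1 \<times> space M2. f p > c} (\<Union>i. A i \<times> B i) \<in> null_sets (M1 \<Otimes>\<^sub>M M2)"
    proof (intro allI impI)
      fix c :: real assume "0 \<le> c"
      obtain A B where AB: "\<forall>i::nat. A i \<in> sets M1 \<and> B i \<in> sets M2"
        and "AE p in M1 \<Otimes>\<^sub>M M2. ennreal c < ennreal (f p) \<longleftrightarrow> p \<in> (\<Union>i. A i \<times> B i)"
        using rect_sum_level_set[OF F \<open>0 \<le> c\<close>] by blast
      then have "AE p in M1 \<Otimes>\<^sub>M M2. c < f p \<longleftrightarrow> p \<in> (\<Union>i. A i \<times> B i)"
        using \<open>0 \<le> c\<close> by (simp add: ennreal_less_iff)
      then show "\<exists>(A :: nat \<Rightarrow> 'a set) B. (\<forall>i. A i \<in> sets M1 \<and> B i \<in> sets M2) \<and>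
          sym_diff {p \<in> space M1 \<times> space M2. f p > c} (\<Union>i. A i \<times> B i) \<in> null_sets (M1 \<Otimes>\<^sub>M M2)"
        using AB by (intro exI[of _ A] exI[of _ B] conjI) (rule AB, simp only: *[OF AB])
    qed
  next
    assume level: "\<forall>c\<ge>0. \<exists>(A :: nat \<Rightarrow> 'a set) B. (\<forall>i. A i \<in> sets M1 \<and> B i \<in> sets M2) \<and>
      sym_diff {p \<in> space M1 \<times> space M2. f p > c} (\<Union>i. A i \<times> B i) \<in> null_sets (M1 \<Otimes>\<^sub>M M2)"
    show "rect_sum M1 M2 (\<lambda>p. ennreal (f p))"
    proof (rule rect_sum_of_level_sets[OF nonneg])
      fix c :: real assume "0 \<le> c"
      with level obtain A B where AB: "\<forall>i::nat. A i \<in> sets M1 \<and> B i \<in> sets M2"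
        and "sym_diff {p \<in> space M1 \<times> space M2. f p > c} (\<Union>i. A i \<times> B i) \<in> null_sets (M1 \<Otimes>\<^sub>M M2)"
        by blast
      then show "\<exists>(A :: nat \<Rightarrow> 'a set) B. (\<forall>i. A i \<in> sets M1 \<and> B i \<in> sets M2) \<and>
          (AE p in M1 \<Otimes>\<^sub>M M2. c < f p \<longleftrightarrow> p \<in> (\<Union>i. A i \<times> B i))"
        using AB by (intro exI[of _ A] exI[of _ B] conjI) (rule AB, simp only: *[OF AB])
    qed
  qed
qed

end

section \<open>Costs of representations and a lower bound for the projective norm\<close>

definition rep_cost ::
    "'a measure \<Rightarrow> 'b measure \<Rightarrow>
     (('a \<Rightarrow> 'k::{real_normed_field, euclidean_space}) \<times> ('b \<Rightarrow> 'k)) list \<Rightarrow> real"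
  where "rep_cost M N t = (\<Sum>(g, h)\<leftarrow>t. L1_norm M g * L1_norm N h)"

lemma rep_cost_nonneg: "0 \<le> rep_cost M N t"
  unfolding rep_cost_def by (intro sum_list_nonneg) (auto simp: L1_norm_nonneg)

lemma proj_norm_le_rep_cost:
  assumes "set t \<subseteq> L1_space M \<times> L1_space N" "same_tensor M N s t"
  shows "proj_norm M N s \<le> rep_cost M N t"
  unfolding proj_norm_def rep_cost_def[symmetric]
  using assms by (intro cInf_lower bdd_belowI[of _ 0]) (auto simp: rep_cost_nonneg)

text \<open>This form serves as a dual certificate: it is bounded by the product of the norms and,
  on pairs of nonnegative functions, equals it.\<close>

lemma L1_bilinear_form_integral_product:
  "L1_bilinear_form M N (\<lambda>g h. integral\<^sup>L M g * (integral\<^sup>L N h :: 'k::{real_normed_field, euclidean_space}))"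
  unfolding L1_bilinear_form_def L1_space_def
  by (auto simp: algebra_simps intro!: integral_cong_AE)

text \<open>A bilinear form takes the same value on all representations of a tensor. For the product
  of integrals, the triangle inequality bounds this value by the cost of each of them, hence by the
  infimum.\<close>

lemma norm_integral_le_proj_norm:
  fixes s :: "(('a \<Rightarrow> 'k::{real_normed_field, euclidean_space}) \<times> ('b \<Rightarrow> 'k)) list"
  assumes s: "set s \<subseteq> L1_space M \<times> L1_space N"
  shows "norm (\<Sum>(g, h)\<leftarrow>s. integral\<^sup>L M g * integral\<^sup>L N h) \<le> proj_norm M N s"
  unfolding proj_norm_def
proof (rule cInf_greatest, safe)
  \<comment> \<open>\<open>s\<close> represents itself, so the infimum is over a nonempty set, as
    \<open>cInf_greatest\<close> requires.\<close>
  have "rep_cost M N s \<in> {\<Sum>(g, h)\<leftarrow>t. L1_norm M g * L1_norm N h | t.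
           set t \<subseteq> L1_space M \<times> L1_space N \<and> same_tensor M N s t}"
    using s by (auto simp: rep_cost_def same_tensor_def)
  moreover assume "{\<Sum>(g, h)\<leftarrow>t. L1_norm M g * L1_norm N h | t.
           set t \<subseteq> L1_space M \<times> L1_space N \<and> same_tensor M N s t} = {}"
  ultimately show False by simp
next
  fix t :: "(('a \<Rightarrow> 'k) \<times> ('b \<Rightarrow> 'k)) list"
  assume "same_tensor M N s t"
  then have "(\<Sum>(g, h)\<leftarrow>s. integral\<^sup>L M g * integral\<^sup>L N h) = (\<Sum>(g, h)\<leftarrow>t. integral\<^sup>L M g * integral\<^sup>L N h)"
    unfolding same_tensor_def using L1_bilinear_form_integral_product by blast
  moreover have "norm (\<Sum>(g, h)\<leftarrow>t. integral\<^sup>L M g * integral\<^sup>L N h) \<le> (\<Sum>(g, h)\<leftarrow>t. L1_norm M g * L1_norm N h)"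
  proof (induction t)
    case (Cons x t)
    obtain g h where x: "x = (g, h)" by fastforce
    have "norm (integral\<^sup>L M g * integral\<^sup>L N h) \<le> L1_norm M g * L1_norm N h"
      unfolding norm_mult L1_norm_def
      by (intro mult_mono integral_norm_bound) auto
    then show ?case
      using Cons.IH by (simp add: x) (rule norm_triangle_le, simp)
  qed simp
  ultimately show "norm (\<Sum>(g, h)\<leftarrow>s. integral\<^sup>L M g * integral\<^sup>L N h) \<le> (\<Sum>(g, h)\<leftarrow>t. L1_norm M g * L1_norm N h)"
    by simp
qed

section \<open>Calculus of a fixed bilinear form\<close>

context
  fixes M :: "'a measure" and N :: "'b measure"
    and \<beta> :: "('a \<Rightarrow> 'k::{real_normed_field, euclidean_space}) \<Rightarrow> ('b \<Rightarrow> 'k) \<Rightarrow> 'k"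
  assumes \<beta>: "L1_bilinear_form M N \<beta>"
begin

lemma L1_bilinear_form_AE_left:
  "integrable M g \<Longrightarrow> integrable M g' \<Longrightarrow> integrable N h \<Longrightarrow> (AE x in M. g x = g' x) \<Longrightarrow> \<beta> g h = \<beta> g' h"
  using \<beta> unfolding L1_bilinear_form_def L1_space_def by blast

lemma L1_bilinear_form_add_left:
  "integrable M g \<Longrightarrow> integrable M g' \<Longrightarrow> integrable N h \<Longrightarrow> \<beta> (\<lambda>x. g x + g' x) h = \<beta> g h + \<beta> g' h"
  using \<beta> unfolding L1_bilinear_form_def L1_space_def by blast

lemma L1_bilinear_form_add_right:
  "integrable M g \<Longrightarrow> integrable N h \<Longrightarrow> integrable N h' \<Longrightarrow> \<beta> g (\<lambda>x. h x + h' x) = \<beta> g h + \<beta> g h'"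
  using \<beta> unfolding L1_bilinear_form_def L1_space_def by blast

lemma L1_bilinear_form_scale:
  assumes "integrable M g" "integrable N h"
  shows "\<beta> (\<lambda>x. c * g x) h = c * \<beta> g h" "\<beta> g (\<lambda>y. c * h y) = c * \<beta> g h"
  using \<beta> assms unfolding L1_bilinear_form_def L1_space_def by blast+

lemma L1_bilinear_form_sum_left:
  assumes "finite I" "\<And>i. i \<in> I \<Longrightarrow> integrable M (g i)" "integrable N h"
  shows "\<beta> (\<lambda>x. \<Sum>i\<in>I. c i * g i x) h = (\<Sum>i\<in>I. c i * \<beta> (g i) h)"
  using assms(1,2)
proof (induction I rule: finite_induct)
  case empty
  \<comment> \<open>Homogeneity with scalar 0 shows that the form vanishes at the zero
    function.\<close>
  show ?case using L1_bilinear_form_scale(1)[of "\<lambda>_. 0" h 0] assms(3) by simp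
next
  case (insert i I)
  have "\<beta> (\<lambda>x. c i * g i x + (\<Sum>i\<in>I. c i * g i x)) h = \<beta> (\<lambda>x. c i * g i x) h + \<beta> (\<lambda>x. \<Sum>i\<in>I. c i * g i x) h"
    using insert assms(3)
    by (intro L1_bilinear_form_add_left Bochner_Integration.integrable_sum integrable_mult_right) auto
  with insert assms(3) show ?case by (simp add: L1_bilinear_form_scale)
qed

lemma L1_bilinear_form_sum_right:
  assumes "finite I" "\<And>i. i \<in> I \<Longrightarrow> integrable N (h i)" "integrable M g"
  shows "\<beta> g (\<lambda>x. \<Sum>i\<in>I. c i * h i x) = (\<Sum>i\<in>I. c i * \<beta> g (h i))"
  using assms(1,2)
proof (induction I rule: finite_induct)
  case empty
  show ?case using L1_bilinear_form_scale(2)[of g "\<lambda>_. 0" 0] assms(3) by simp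
next
  case (insert i I)
  have "\<beta> g (\<lambda>x. c i * h i x + (\<Sum>i\<in>I. c i * h i x)) = \<beta> g (\<lambda>x. c i * h i x) + \<beta> g (\<lambda>x. \<Sum>i\<in>I. c i * h i x)"
    using insert assms(3)
    by (intro L1_bilinear_form_add_right Bochner_Integration.integrable_sum integrable_mult_right) auto
  with insert assms(3) show ?case by (simp add: L1_bilinear_form_scale)
qed

end

section \<open>The projective norm is at most the norm of the associated function\<close>

text \<open>The Bochner integral is defined through simple functions converging in mean; one that is
  far enough along the sequence will do.\<close>

lemma integrable_L1_approx_simple:
  fixes g :: "'a \<Rightarrow> 'k::{banach, second_countable_topology}"
  assumes g: "integrable M g" and "0 < \<delta>"
  shows "\<exists>s. Bochner_Integration.simple_bochner_integrable M s \<and> L1_norm M (\<lambda>x. g x - s x) < \<delta>"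
proof -
  from g obtain I where "has_bochner_integral M g I" by (auto simp: integrable.simps)
  then obtain s where s: "\<And>i. Bochner_Integration.simple_bochner_integrable M (s i)"
    and lim: "(\<lambda>i. \<integral>\<^sup>+x. norm (g x - s i x) \<partial>M) \<longlonglongrightarrow> 0"
    by (auto simp: has_bochner_integral.simps)
  have "eventually (\<lambda>i. (\<integral>\<^sup>+x. norm (g x - s i x) \<partial>M) < ennreal \<delta>) sequentially"
    using lim \<open>0 < \<delta>\<close> by (intro order_tendstoD(2)) auto
  then obtain i where i: "(\<integral>\<^sup>+x. norm (g x - s i x) \<partial>M) < ennreal \<delta>"
    by (auto simp: eventually_sequentially)
  have "integrable M (s i)"
    using has_bochner_integral_simple_bochner_integrable[OF s] by (auto simp: integrable.simps)
  then have "(\<integral>\<^sup>+x. norm (g x - s i x) \<partial>M) = ennreal (L1_norm M (\<lambda>x. g x - s i x))"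
    unfolding L1_norm_def using g by (intro nn_integral_eq_integral) auto
  with i s show ?thesis by (auto simp: ennreal_less_iff L1_norm_nonneg)
qed

text \<open>If \<open>G x\<close> is the omitted value \<open>z\<close>, no summand survives and the
  right side is \<open>F z = 0\<close>; otherwise exactly the summand \<open>v = G x\<close>
  survives.\<close>

lemma sum_over_value:
  assumes "finite V" "V = G ` S - {z}" "x \<in> S" "F z = 0"
  shows "(\<Sum>v\<in>V. if G x = v then F v else 0) = F (G x)"
  using assms by (subst sum.delta') auto

context pair_sigma_finite
begin

text \<open>
  Grouping by the value vector \<open>v\<close> of \<open>(s\<^sub>1, \<dots>, s\<^sub>n)\<close> turns \<open>\<Sum>i. s\<^sub>i \<otimes> h\<^sub>i\<close> into
  \<open>\<Sum>v. \<chi>\<^bsub>A v\<^esub> \<otimes> (\<Sum>i. v\<^sub>i h\<^sub>i)\<close> with disjoint sets \<open>A v\<close>, for which the cost of the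
  representation is the \<open>L\<^sub>1\<close>-norm.
\<close>

lemma simple_tensor_representation:
  fixes s :: "nat \<Rightarrow> 'a \<Rightarrow> 'k::{real_normed_field, euclidean_space}" and h :: "nat \<Rightarrow> 'b \<Rightarrow> 'k"
  assumes s: "\<And>i. i < n \<Longrightarrow> Bochner_Integration.simple_bochner_integrable M1 (s i)"
    and h: "\<And>i. i < n \<Longrightarrow> integrable M2 (h i)"
  shows "\<exists>t. set t \<subseteq> L1_space M1 \<times> L1_space M2 \<and>
    same_tensor M1 M2 (map (\<lambda>i. (s i, h i)) [0..<n]) t \<and>
    rep_cost M1 M2 t = L1_norm (M1 \<Otimes>\<^sub>M M2) (\<lambda>p. \<Sum>i<n. tensor (s i) (h i) p)"
proof -
  have s_int: "integrable M1 (s i)" if "i < n" for i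
    using has_bochner_integral_simple_bochner_integrable[OF s[OF that]] by (auto simp: integrable.simps)
  define G where "G x = map (\<lambda>i. s i x) [0..<n]" for x
  \<comment> \<open>The zero vector is left out: its preimage may have infinite measure, so its
    indicator need not be integrable, and it contributes nothing to the tensor.\<close>
  define V where "V = G ` space M1 - {replicate n 0}"
  have G_nth: "G x ! i = s i x" if "i < n" for x i using that by (simp add: G_def)
  have "finite (\<Union>i<n. s i ` space M1)"
    using s by (auto simp: simple_bochner_integrable.simps simple_function_def)
  then have "finite {xs. set xs \<subseteq> (\<Union>i<n. s i ` space M1) \<and> length xs = n}"
    by (rule finite_lists_length_eq)
  then have finV: "finite V"
    by (rule finite_subset[rotated]) (auto simp: V_def G_def intro!: bexI imageI)
  define A where "A v = {x \<in> space M1. G x = v}" for v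
  have A_sets: "A v \<in> sets M1" and A_fin: "emeasure M1 (A v) < \<infinity>" if "v \<in> V" for v
  proof -
    from that have len: "length v = n" by (auto simp: V_def G_def)
    have "A v = {x \<in> space M1. \<forall>i\<in>{..<n}. s i x = v ! i}"
      unfolding A_def using len by (auto simp: G_def list_eq_iff_nth_eq)
    also have "\<dots> \<in> sets M1"
    proof (intro sets.sets_Collect_finite_All)
      fix i assume "i \<in> {..<n}"
      then have [measurable]: "s i \<in> borel_measurable M1" using s_int by auto
      show "{x \<in> space M1. s i x = v ! i} \<in> sets M1" by measurable
    qed simp
    finally show *: "A v \<in> sets M1" .
    \<comment> \<open>A nonzero coordinate places \<open>A v\<close> inside the support of some
      \<open>s i\<close>, which has finite measure.\<close>
    from that len have "\<exists>i<n. v ! i \<noteq> 0"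
      by (auto simp: V_def list_eq_iff_nth_eq)
    then obtain i where i: "i < n" "v ! i \<noteq> 0" by auto
    then have "A v \<subseteq> {x \<in> space M1. s i x \<noteq> 0}" by (auto simp: A_def G_nth)
    moreover have "{x \<in> space M1. s i x \<noteq> 0} \<in> sets M1"
      using s_int[OF i(1)] by (auto dest!: borel_measurable_integrable)
    ultimately have "emeasure M1 (A v) \<le> emeasure M1 {x \<in> space M1. s i x \<noteq> 0}"
      by (rule emeasure_mono)
    also have "\<dots> < \<infinity>"
      using s[OF i(1)] by (auto simp: simple_bochner_integrable.simps less_top)
    finally show "emeasure M1 (A v) < \<infinity>" .
  qed
  define a where "a v = (indicator (A v) :: 'a \<Rightarrow> 'k)" for v
  define w where "w v y = (\<Sum>i<n. v ! i * h i y)" for v :: "'k list" and y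
  have a_int: "integrable M1 (a v)" if "v \<in> V" for v
  proof -
    have "integrable M1 (\<lambda>x. indicator (A v) x *\<^sub>R (1::'k))"
      using A_sets[OF that] A_fin[OF that] by simp
    moreover have "(\<lambda>x. indicator (A v) x *\<^sub>R (1::'k)) = a v"
      by (auto simp: a_def indicator_def)
    ultimately show ?thesis by simp
  qed
  have w_int: "integrable M2 (w v)" for v
    unfolding w_def using h by (intro Bochner_Integration.integrable_sum integrable_mult_right) auto
  obtain vs where vs: "set vs = V" "distinct vs" using finite_distinct_list[OF finV] by blast
  define t where "t = map (\<lambda>v. (a v, w v)) vs"
  have same: "same_tensor M1 M2 (map (\<lambda>i. (s i, h i)) [0..<n]) t"
    unfolding same_tensor_def
  proof (intro allI impI)
    fix \<beta> :: "('a \<Rightarrow> 'k) \<Rightarrow> ('b \<Rightarrow> 'k) \<Rightarrow> 'k"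
    assume \<beta>: "L1_bilinear_form M1 M2 \<beta>"
    have "(\<Sum>(g, h)\<leftarrow>map (\<lambda>i. (s i, h i)) [0..<n]. \<beta> g h) = (\<Sum>i<n. \<beta> (s i) (h i))"
      by (simp add: o_def sum_list_distinct_conv_sum_set atLeast0LessThan)
    also have "\<dots> = (\<Sum>i<n. \<Sum>v\<in>V. v ! i * \<beta> (a v) (h i))"
    proof (rule sum.cong[OF refl])
      fix i assume "i \<in> {..<n}"
      then have i: "i < n" by simp
      have "s i x = (\<Sum>v\<in>V. v ! i * a v x)" if "x \<in> space M1" for x
      proof -
        have "(\<Sum>v\<in>V. v ! i * a v x) = (\<Sum>v\<in>V. if G x = v then v ! i else 0)"
          using that by (intro sum.cong) (auto simp: a_def A_def indicator_def)
        also have "\<dots> = G x ! i"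
          using i by (intro sum_over_value[OF finV V_def that]) simp
        finally show ?thesis using i by (simp add: G_nth)
      qed
      then have "\<beta> (s i) (h i) = \<beta> (\<lambda>x. \<Sum>v\<in>V. v ! i * a v x) (h i)"
        using i by (intro L1_bilinear_form_AE_left[OF \<beta>] s_int h AE_I2
            Bochner_Integration.integrable_sum integrable_mult_right a_int) auto
      also have "\<dots> = (\<Sum>v\<in>V. v ! i * \<beta> (a v) (h i))"
        using i by (intro L1_bilinear_form_sum_left[OF \<beta>] finV a_int h)
      finally show "\<beta> (s i) (h i) = (\<Sum>v\<in>V. v ! i * \<beta> (a v) (h i))" .
    qed
    also have "\<dots> = (\<Sum>v\<in>V. \<Sum>i<n. v ! i * \<beta> (a v) (h i))"
      by (rule sum.swap)
    also have "\<dots> = (\<Sum>v\<in>V. \<beta> (a v) (w v))"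
      unfolding w_def using h by (intro sum.cong refl L1_bilinear_form_sum_right[OF \<beta>, symmetric] a_int) auto
    also have "\<dots> = (\<Sum>(g, h)\<leftarrow>t. \<beta> g h)" 
      by (simp add: t_def o_def sum_list_distinct_conv_sum_set vs)
    finally show "(\<Sum>(g, h)\<leftarrow>map (\<lambda>i. (s i, h i)) [0..<n]. \<beta> g h) = (\<Sum>(g, h)\<leftarrow>t. \<beta> g h)" .
  qed
  \<comment> \<open>At each point at most one \<open>v\<close> contributes, so the norm of the sum
    equals the sum of the norms. This disjointness is what makes the cost exact.\<close>
  have "L1_norm (M1 \<Otimes>\<^sub>M M2) (\<lambda>p. \<Sum>i<n. tensor (s i) (h i) p)
      = (\<integral>p. (\<Sum>v\<in>V. norm (tensor (a v) (w v) p)) \<partial>(M1 \<Otimes>\<^sub>M M2))"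
    unfolding L1_norm_def
  proof (rule Bochner_Integration.integral_cong[OF refl])
    fix p assume "p \<in> space (M1 \<Otimes>\<^sub>M M2)"
    then obtain x y where p: "p = (x, y)" "x \<in> space M1" by (auto simp: space_pair_measure)
    have "(\<Sum>v\<in>V. norm (tensor (a v) (w v) p)) = (\<Sum>v\<in>V. if G x = v then norm (w v y) else 0)"
      using p by (intro sum.cong) (auto simp: tensor_def a_def A_def indicator_def)
    also have "\<dots> = norm (w (G x) y)"
      by (rule sum_over_value[OF finV V_def p(2)]) (simp add: w_def)
    finally show "norm (\<Sum>i<n. tensor (s i) (h i) p) = (\<Sum>v\<in>V. norm (tensor (a v) (w v) p))"
      by (simp add: p(1) tensor_def w_def G_nth)
  qed
  also have "\<dots> = (\<Sum>v\<in>V. L1_norm (M1 \<Otimes>\<^sub>M M2) (tensor (a v) (w v)))"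
    unfolding L1_norm_def by (intro Bochner_Integration.integral_sum integrable_norm integrable_tensor a_int w_int)
  also have "\<dots> = (\<Sum>v\<in>V. L1_norm M1 (a v) * L1_norm M2 (w v))"
    by (intro sum.cong refl integrable_tensor a_int w_int)
  also have "\<dots> = rep_cost M1 M2 t"
    unfolding rep_cost_def 
      by (simp add: t_def o_def sum_list_distinct_conv_sum_set vs)
  finally have "rep_cost M1 M2 t = L1_norm (M1 \<Otimes>\<^sub>M M2) (\<lambda>p. \<Sum>i<n. tensor (s i) (h i) p)" ..
  moreover have "set t \<subseteq> L1_space M1 \<times> L1_space M2"
    using a_int w_int by (auto simp: t_def vs L1_space_def)
  ultimately show ?thesis using same by blast
qed

text \<open>Each \<open>g i\<close> is approximated in mean by a simple function \<open>s i\<close>.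
  The tensor built from the \<open>s i\<close> has a representation whose cost is its function norm,
  and the tensor of the errors is cheap, so the bound holds up to an arbitrary
  \<open>e\<close>.\<close>

lemma proj_norm_le_L1_norm:
  fixes g :: "nat \<Rightarrow> 'a \<Rightarrow> 'k::{real_normed_field, euclidean_space}" and h :: "nat \<Rightarrow> 'b \<Rightarrow> 'k"
  assumes g: "\<And>i. integrable M1 (g i)" and h: "\<And>i. integrable M2 (h i)"
  shows "proj_norm M1 M2 (map (\<lambda>i. (g i, h i)) [0..<n]) \<le>
    L1_norm (M1 \<Otimes>\<^sub>M M2) (\<lambda>p. \<Sum>i<n. tensor (g i) (h i) p)"
    (is "?P \<le> ?L")
proof (rule field_le_epsilon)
  fix e :: real assume "0 < e"
  define H where "H = (\<Sum>i<n. L1_norm M2 (h i))"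
  have "0 \<le> H" unfolding H_def by (intro sum_nonneg L1_norm_nonneg)
  \<comment> \<open>The error \<open>\<delta> * H\<close> enters twice: as the cost of the
    correction list \<open>r\<close>, and in replacing the norm for \<open>s\<close> by the norm for
    \<open>g\<close>. The \<open>+ 1\<close> avoids division by zero.\<close>
  define \<delta> where "\<delta> = e / (2 * (H + 1))"
  have "0 < \<delta>" using \<open>0 < e\<close> \<open>0 \<le> H\<close> by (simp add: \<delta>_def)
  have \<delta>: "2 * (\<delta> * H) \<le> e"
    using \<open>0 < e\<close> \<open>0 \<le> H\<close> by (simp add: \<delta>_def field_simps)
  have "\<forall>i. \<exists>s. Bochner_Integration.simple_bochner_integrable M1 s \<and> L1_norm M1 (\<lambda>x. g i x - s x) < \<delta>"
    using integrable_L1_approx_simple[OF g \<open>0 < \<delta>\<close>] by blast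
  from choice[OF this] obtain s
    where s: "\<And>i. Bochner_Integration.simple_bochner_integrable M1 (s i)"
      and s_approx: "\<And>i. L1_norm M1 (\<lambda>x. g i x - s i x) < \<delta>" by blast
  have s_int: "integrable M1 (s i)" for i
    using has_bochner_integral_simple_bochner_integrable[OF s] by (auto simp: integrable.simps)
  obtain t where t: "set t \<subseteq> L1_space M1 \<times> L1_space M2"
    and same: "same_tensor M1 M2 (map (\<lambda>i. (s i, h i)) [0..<n]) t"
    and cost: "rep_cost M1 M2 t = L1_norm (M1 \<Otimes>\<^sub>M M2) (\<lambda>p. \<Sum>i<n. tensor (s i) (h i) p)"
    using simple_tensor_representation[of n s h] s h by blast
  define d where "d i x = g i x - s i x" for i x
  have d_int: "integrable M1 (d i)" for i unfolding d_def using g s_int by simp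
  define r where "r = map (\<lambda>i. (d i, h i)) [0..<n]"
  have r_cost: "(\<Sum>i<n. L1_norm M1 (d i) * L1_norm M2 (h i)) \<le> \<delta> * H"
    unfolding H_def sum_distrib_left d_def
    using s_approx by (intro sum_mono mult_right_mono L1_norm_nonneg) (auto intro: less_imp_le)
  have "same_tensor M1 M2 (map (\<lambda>i. (g i, h i)) [0..<n]) (r @ t)"
    unfolding same_tensor_def
  proof (intro allI impI)
    fix \<beta> :: "('a \<Rightarrow> 'k) \<Rightarrow> ('b \<Rightarrow> 'k) \<Rightarrow> 'k"
    assume \<beta>: "L1_bilinear_form M1 M2 \<beta>"
    have "\<beta> (g i) (h i) = \<beta> (d i) (h i) + \<beta> (s i) (h i)" for i
      using L1_bilinear_form_add_left[OF \<beta> d_int s_int h, of i i i] by (simp add: d_def)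
    then have "(\<Sum>(g, h)\<leftarrow>map (\<lambda>i. (g i, h i)) [0..<n]. \<beta> g h) =
        (\<Sum>(g, h)\<leftarrow>r. \<beta> g h) + (\<Sum>(g, h)\<leftarrow>map (\<lambda>i. (s i, h i)) [0..<n]. \<beta> g h)"
      by (simp add: r_def o_def sum_list_addf)
    also have "(\<Sum>(g, h)\<leftarrow>map (\<lambda>i. (s i, h i)) [0..<n]. \<beta> g h) = (\<Sum>(g, h)\<leftarrow>t. \<beta> g h)"
      using same \<beta> unfolding same_tensor_def by blast
    finally show "(\<Sum>(g, h)\<leftarrow>map (\<lambda>i. (g i, h i)) [0..<n]. \<beta> g h) = (\<Sum>(g, h)\<leftarrow>r @ t. \<beta> g h)"
      by simp
  qed
  moreover have "set (r @ t) \<subseteq> L1_space M1 \<times> L1_space M2"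
    using t d_int h by (auto simp: r_def L1_space_def)
  ultimately have "?P \<le> rep_cost M1 M2 (r @ t)"
    by (intro proj_norm_le_rep_cost)
  also have "\<dots> = (\<Sum>i<n. L1_norm M1 (d i) * L1_norm M2 (h i)) +
      L1_norm (M1 \<Otimes>\<^sub>M M2) (\<lambda>p. \<Sum>i<n. tensor (s i) (h i) p)"
    unfolding cost[symmetric]
    by (simp add: rep_cost_def r_def o_def sum_list_distinct_conv_sum_set atLeast0LessThan)
  also have "L1_norm (M1 \<Otimes>\<^sub>M M2) (\<lambda>p. \<Sum>i<n. tensor (s i) (h i) p) \<le>
      ?L + (\<Sum>i<n. L1_norm (M1 \<Otimes>\<^sub>M M2) (tensor (d i) (h i)))"
  proof -
    have "L1_norm (M1 \<Otimes>\<^sub>M M2) (\<lambda>p. \<Sum>i<n. tensor (s i) (h i) p) \<le>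
      (\<integral>p. norm (\<Sum>i<n. tensor (g i) (h i) p) + (\<Sum>i<n. norm (tensor (d i) (h i) p)) \<partial>(M1 \<Otimes>\<^sub>M M2))"
      unfolding L1_norm_def
    proof (rule integral_mono)
      fix p
      have "(\<Sum>i<n. tensor (s i) (h i) p) = (\<Sum>i<n. tensor (g i) (h i) p) - (\<Sum>i<n. tensor (d i) (h i) p)"
        by (simp add: tensor_def d_def split_beta algebra_simps flip: sum_subtractf)
      also have "norm \<dots> \<le> norm (\<Sum>i<n. tensor (g i) (h i) p) + norm (\<Sum>i<n. tensor (d i) (h i) p)"
        by (rule norm_triangle_ineq4)
      also have "norm (\<Sum>i<n. tensor (d i) (h i) p) \<le> (\<Sum>i<n. norm (tensor (d i) (h i) p))"
        by (rule norm_sum)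
      finally show "norm (\<Sum>i<n. tensor (s i) (h i) p) \<le>
          norm (\<Sum>i<n. tensor (g i) (h i) p) + (\<Sum>i<n. norm (tensor (d i) (h i) p))" by simp
    qed (intro Bochner_Integration.integrable_add integrable_norm Bochner_Integration.integrable_sum
        integrable_tensor g h d_int s_int)+
    also have "\<dots> = ?L + (\<integral>p. (\<Sum>i<n. norm (tensor (d i) (h i) p)) \<partial>(M1 \<Otimes>\<^sub>M M2))"
      unfolding L1_norm_def
      by (intro Bochner_Integration.integral_add integrable_norm Bochner_Integration.integrable_sum
          integrable_tensor g h d_int)
    also have "(\<integral>p. (\<Sum>i<n. norm (tensor (d i) (h i) p)) \<partial>(M1 \<Otimes>\<^sub>M M2)) =
        (\<Sum>i<n. L1_norm (M1 \<Otimes>\<^sub>M M2) (tensor (d i) (h i)))"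
      unfolding L1_norm_def
      by (intro Bochner_Integration.integral_sum integrable_norm integrable_tensor h d_int)
    finally show ?thesis .
  qed
  also have "(\<Sum>i<n. L1_norm (M1 \<Otimes>\<^sub>M M2) (tensor (d i) (h i))) = (\<Sum>i<n. L1_norm M1 (d i) * L1_norm M2 (h i))"
    by (intro sum.cong refl integrable_tensor h d_int)
  finally show "?P \<le> ?L + e" using r_cost \<delta> by linarith
qed

section \<open>Norm attainment and rectangle sums\<close>

text \<open>The total cost \<open>K\<close> of an attaining representation is at most the integral
  of \<open>f\<close>, while the sum \<open>W\<close> of the absolute products dominates
  \<open>f\<close> and has integral \<open>K\<close>. Hence \<open>W = f\<close> almost everywhere,
  and \<open>W\<close> is a countable sum of products, each covered by
  \<open>rect_sum_product\<close>.\<close>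

lemma NA_proj_imp_rect_sum:
  fixes f :: "'a \<times> 'b \<Rightarrow> real"
  assumes f[measurable]: "integrable (M1 \<Otimes>\<^sub>M M2) f" and nonneg: "AE p in M1 \<Otimes>\<^sub>M M2. 0 \<le> f p"
    and NA: "(\<lambda>p. of_real (f p) :: 'k::{real_normed_field, euclidean_space}) \<in> NA_proj M1 M2"
  shows "rect_sum M1 M2 (\<lambda>p. ennreal (f p))"
proof -
  let ?M = "M1 \<Otimes>\<^sub>M M2"
  let ?F = "\<lambda>p. of_real (f p) :: 'k"
  obtain g :: "nat \<Rightarrow> 'a \<Rightarrow> 'k" and h :: "nat \<Rightarrow> 'b \<Rightarrow> 'k"
    where g: "\<And>i. integrable M1 (g i)" and h: "\<And>i. integrable M2 (h i)"
    and summ: "summable (\<lambda>i. L1_norm M1 (g i) * L1_norm M2 (h i))"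
    and sums: "L1_sums ?M (\<lambda>i. tensor (g i) (h i)) ?F"
    and proj: "(\<lambda>n. proj_norm M1 M2 (map (\<lambda>i. (g i, h i)) [0..<n]))
      \<longlonglongrightarrow> (\<Sum>i. L1_norm M1 (g i) * L1_norm M2 (h i))"
    using NA unfolding NA_proj_def L1_space_def by blast
  define K where "K = (\<Sum>i. L1_norm M1 (g i) * L1_norm M2 (h i))"
  have [measurable]: "g i \<in> borel_measurable M1" "h i \<in> borel_measurable M2" for i
    using g[of i] h[of i] by auto
  have T_int: "integrable ?M (tensor (g i) (h i))" for i
    using g h by (rule integrable_tensor)
  have F_int: "integrable ?M ?F" using f by simp
  have D_int: "integrable ?M (\<lambda>p. ?F p - (\<Sum>i<n. tensor (g i) (h i) p))" for n
    by (intro Bochner_Integration.integrable_diff Bochner_Integration.integrable_sum T_int F_int)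
  have lim: "(\<lambda>n. L1_norm ?M (\<lambda>p. ?F p - (\<Sum>i<n. tensor (g i) (h i) p))) \<longlonglongrightarrow> 0"
    using sums unfolding L1_sums_def by blast
  \<comment> \<open>\<open>K\<close> is the limit of the projective norms of the partial sums. Each
    is at most the norm of the partial sum as a function, hence at most that of \<open>?F\<close>
    plus a remainder tending to 0.\<close>
  have "K \<le> L1_norm ?M ?F"
  proof (rule LIMSEQ_le)
    show "(\<lambda>n. proj_norm M1 M2 (map (\<lambda>i. (g i, h i)) [0..<n])) \<longlonglongrightarrow> K"
      using proj by (simp add: K_def)
    show "(\<lambda>n. L1_norm ?M ?F + L1_norm ?M (\<lambda>p. ?F p - (\<Sum>i<n. tensor (g i) (h i) p))) \<longlonglongrightarrow> L1_norm ?M ?F"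
      using tendsto_add[OF tendsto_const lim] by simp
    have "proj_norm M1 M2 (map (\<lambda>i. (g i, h i)) [0..<n]) \<le>
      L1_norm ?M ?F + L1_norm ?M (\<lambda>p. ?F p - (\<Sum>i<n. tensor (g i) (h i) p))" for n
    proof -
      have "proj_norm M1 M2 (map (\<lambda>i. (g i, h i)) [0..<n]) \<le> L1_norm ?M (\<lambda>p. \<Sum>i<n. tensor (g i) (h i) p)"
        using g h by (rule proj_norm_le_L1_norm)
      also have "\<dots> \<le> (\<integral>p. norm (?F p) + norm (?F p - (\<Sum>i<n. tensor (g i) (h i) p)) \<partial>?M)"
        unfolding L1_norm_def
      proof (rule integral_mono)
        show "norm (\<Sum>i<n. tensor (g i) (h i) p) \<le> norm (?F p) + norm (?F p - (\<Sum>i<n. tensor (g i) (h i) p))" for p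
          using norm_triangle_ineq4[of "?F p" "?F p - (\<Sum>i<n. tensor (g i) (h i) p)"] by simp
      qed (intro Bochner_Integration.integrable_add integrable_norm Bochner_Integration.integrable_sum T_int F_int D_int)+
      also have "\<dots> = L1_norm ?M ?F + L1_norm ?M (\<lambda>p. ?F p - (\<Sum>i<n. tensor (g i) (h i) p))"
        unfolding L1_norm_def by (intro Bochner_Integration.integral_add integrable_norm F_int D_int)
      finally show ?thesis .
    qed
    then show "\<exists>n0. \<forall>n\<ge>n0. proj_norm M1 M2 (map (\<lambda>i. (g i, h i)) [0..<n]) \<le>
      L1_norm ?M ?F + L1_norm ?M (\<lambda>p. ?F p - (\<Sum>i<n. tensor (g i) (h i) p))" by blast
  qed
  also have "L1_norm ?M ?F = (\<integral>p. f p \<partial>?M)"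
    unfolding L1_norm_def
  proof (rule integral_cong_AE)
    show "AE p in ?M. norm (?F p) = f p" using nonneg by eventually_elim simp
  qed measurable
  finally have K_le: "K \<le> (\<integral>p. f p \<partial>?M)" .
  define W where "W p = (\<Sum>i. ennreal (norm (g i (fst p)) * norm (h i (snd p))))" for p
  have [measurable]: "W \<in> borel_measurable ?M" unfolding W_def by measurable
  have T_norm: "norm (tensor (g i) (h i) p) = norm (g i (fst p)) * norm (h i (snd p))" for i p
    by (simp add: tensor_def split_beta norm_mult)
  have "(\<integral>\<^sup>+p. W p \<partial>?M) = (\<Sum>i. \<integral>\<^sup>+p. ennreal (norm (tensor (g i) (h i) p)) \<partial>?M)"
    unfolding W_def T_norm by (rule nn_integral_suminf) measurable
  also have "\<dots> = (\<Sum>i. ennreal (L1_norm M1 (g i) * L1_norm M2 (h i)))"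
  proof (rule suminf_cong)
    fix i
    have "(\<integral>\<^sup>+p. ennreal (norm (tensor (g i) (h i) p)) \<partial>?M) = ennreal (L1_norm ?M (tensor (g i) (h i)))"
      unfolding L1_norm_def by (intro nn_integral_eq_integral integrable_norm T_int) auto
    then show "(\<integral>\<^sup>+p. ennreal (norm (tensor (g i) (h i) p)) \<partial>?M) = ennreal (L1_norm M1 (g i) * L1_norm M2 (h i))"
      using integrable_tensor(2)[OF g h] by simp
  qed
  also have "\<dots> = ennreal K"
    unfolding K_def using summ by (intro suminf_ennreal2) (auto simp: L1_norm_nonneg)
  finally have W_int: "(\<integral>\<^sup>+p. W p \<partial>?M) = ennreal K" .
  have f_int: "(\<integral>\<^sup>+p. ennreal (f p) \<partial>?M) = ennreal (\<integral>p. f p \<partial>?M)"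
    using f nonneg by (rule nn_integral_eq_integral)
  obtain r where "strict_mono r"
    and r: "AE p in ?M. (\<lambda>n. ?F p - (\<Sum>i<r n. tensor (g i) (h i) p)) \<longlonglongrightarrow> 0"
    using tendsto_L1_AE_subseq[OF D_int lim[unfolded L1_norm_def]] by blast
  \<comment> \<open>Along the subsequence \<open>r\<close> the partial sums converge to
    \<open>?F\<close> almost everywhere, and the norm of every partial sum is at most
    \<open>W\<close>.\<close>
  have f_le: "AE p in ?M. ennreal (f p) \<le> W p"
    using r nonneg
  proof eventually_elim
    case (elim p)
    have "(\<lambda>n. ?F p - (?F p - (\<Sum>i<r n. tensor (g i) (h i) p))) \<longlonglongrightarrow> ?F p - 0"
      by (intro tendsto_intros elim(1))
    then have norm_lim: "(\<lambda>n. ennreal (norm (\<Sum>i<r n. tensor (g i) (h i) p))) \<longlonglongrightarrow> ennreal (norm (?F p))"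
      by (intro tendsto_ennrealI tendsto_norm) simp
    have "ennreal (norm (\<Sum>i<r n. tensor (g i) (h i) p)) \<le> W p" for n
    proof -
      have "ennreal (norm (\<Sum>i<r n. tensor (g i) (h i) p)) \<le> ennreal (\<Sum>i<r n. norm (tensor (g i) (h i) p))"
        by (intro ennreal_leI norm_sum)
      also have "\<dots> = (\<Sum>i<r n. ennreal (norm (tensor (g i) (h i) p)))"
        by (simp add: sum_ennreal)
      also have "\<dots> \<le> W p"
        unfolding W_def T_norm by (intro sum_le_suminf) auto
      finally show ?thesis .
    qed
    then have "ennreal (norm (?F p)) \<le> W p"
      by (intro LIMSEQ_le_const2[OF norm_lim] exI allI impI)
    then show ?case using elim(2) by simp
  qed
  \<comment> \<open>Subtraction in \<open>ennreal\<close> is truncated, so \<open>f_le\<close> is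
    needed both to split this integral and to conclude equality from a zero difference.\<close>
  have "(\<integral>\<^sup>+p. W p - ennreal (f p) \<partial>?M) = (\<integral>\<^sup>+p. W p \<partial>?M) - (\<integral>\<^sup>+p. ennreal (f p) \<partial>?M)"
    using f_le by (intro nn_integral_diff) (auto simp: f_int)
  also have "\<dots> = 0"
    unfolding W_int f_int using K_le by (simp add: diff_eq_0_iff_ennreal ennreal_leI)
  finally have "AE p in ?M. W p - ennreal (f p) = 0"
    by (subst (asm) nn_integral_0_iff_AE) auto
  then have "AE p in ?M. W p = ennreal (f p)"
    using f_le by eventually_elim (simp add: diff_eq_0_iff_ennreal antisym)
  moreover have "rect_sum M1 M2 W"
    unfolding W_def by (intro rect_sum_suminf rect_sum_product) auto
  ultimately show ?thesis by (rule rect_sum_cong_AE[rotated])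
qed

text \<open>Each rectangle becomes a tensor of nonnegative functions, on which the product of
  integrals equals the cost. So every partial sum has projective norm equal to its cost, and the
  limit of the costs is the sum required in \<open>NA_proj\<close>.\<close>

lemma rect_sums_imp_NA_proj:
  fixes f :: "'a \<times> 'b \<Rightarrow> real"
  assumes c: "\<And>i. 0 \<le> c i \<and> A i \<in> sets M1 \<and> B i \<in> sets M2"
    and sums: "L1_sums (M1 \<Otimes>\<^sub>M M2)
      (\<lambda>i p. c i * tensor (indicator (A i)) (indicator (B i)) p) f"
  shows "(\<lambda>p. of_real (f p) :: 'k::{real_normed_field, euclidean_space}) \<in> NA_proj M1 M2"
proof -
  let ?M = "M1 \<Otimes>\<^sub>M M2"
  let ?F = "\<lambda>p. of_real (f p) :: 'k"
  define u where "u i p = c i * tensor (indicator (A i)) (indicator (B i)) p" for i p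
  have u: "u i p = c i * indicator (A i \<times> B i) p" for i p
    by (cases p) (simp add: u_def tensor_def indicator_times)
  have u0: "0 \<le> u i p" for i p using c by (simp add: u)
  have sums': "L1_sums ?M u f" using sums by (simp only: u_def[abs_def])
  have u_int: "\<And>i. integrable ?M (u i)" and f_int: "integrable ?M f"
    and lim: "(\<lambda>n. L1_norm ?M (\<lambda>p. f p - (\<Sum>i<n. u i p))) \<longlonglongrightarrow> 0"
    using sums' by (simp_all add: L1_sums_def L1_space_def)
  \<comment> \<open>The factors \<open>g i\<close> and \<open>h i\<close> must be integrable
    separately, so a term with a side of infinite measure, or with coefficient 0, is replaced by the
    zero tensor; \<open>ab\<close> shows that this changes it only on a null set.\<close>
  define good where "good i \<longleftrightarrow> 0 < c i \<and> emeasure M1 (A i) < \<infinity> \<and> emeasure M2 (B i) < \<infinity>" for i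
  define a where "a i x = (if good i then c i * indicator (A i) x else 0)" for i x
  define b where "b i y = (if good i then indicator (B i) y else 0 :: real)" for i y
  define g where "g i x = (of_real (a i x) :: 'k)" for i x
  define h where "h i y = (of_real (b i y) :: 'k)" for i y
  have a_int: "integrable M1 (a i)" for i
  proof (cases "good i")
    case True
    then have "integrable M1 (\<lambda>x. c i * indicator (A i) x)"
      using c[of i] by (intro integrable_mult_right integrable_real_indicator) (auto simp: good_def)
    with True show ?thesis by (simp add: a_def[abs_def])
  qed (simp add: a_def[abs_def])
  have b_int: "integrable M2 (b i)" for i
  proof (cases "good i")
    case True
    then have "integrable M2 (indicator (B i) :: _ \<Rightarrow> real)"
      using c[of i] by (intro integrable_real_indicator) (auto simp: good_def)
    with True show ?thesis by (simp add: b_def[abs_def])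
  qed (simp add: b_def[abs_def])
  have g_int: "integrable M1 (g i)" and h_int: "integrable M2 (h i)" for i
    using a_int b_int by (simp_all add: g_def[abs_def] h_def[abs_def])
  have ab0: "0 \<le> a i x" "0 \<le> b i y" for i x y
    using c by (simp_all add: a_def b_def)
  have T: "tensor (g i) (h i) p = of_real (a i (fst p) * b i (snd p))" for i p
    by (simp add: tensor_def split_beta g_def h_def)
  have T_int: "integrable ?M (tensor (g i) (h i))" for i
    using g_int h_int by (rule integrable_tensor)
  text \<open>A rectangle of finite measure may have a side of infinite measure if the other one is null.\<close>
  have ab: "AE p in ?M. a i (fst p) * b i (snd p) = u i p" for i
  proof (cases "good i \<or> c i = 0")
    case True
    then show ?thesis
      by (auto simp: a_def b_def u good_def indicator_def mem_Times_iff)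
  next
    case False
    then have bad: "0 < c i" "emeasure M1 (A i) = \<infinity> \<or> emeasure M2 (B i) = \<infinity>" "\<not> good i"
      using c[of i] by (auto simp: good_def not_less top_unique)
    have "A i \<times> B i \<in> sets ?M" using c[of i] by auto
    have "u i = (\<lambda>p. c i * indicator (A i \<times> B i) p)" by (auto simp: u)
    then have "integrable ?M (indicator (A i \<times> B i) :: _ \<Rightarrow> real)"
      using u_int[of i] bad(1) by simp
    then have "emeasure ?M (A i \<times> B i) < \<infinity>"
      using \<open>A i \<times> B i \<in> sets ?M\<close> by (simp add: integrable_indicator_iff)
    then have "emeasure ?M (A i \<times> B i) = 0"
      using bad(2) c[of i] by (auto simp: M2.emeasure_pair_measure_Times ennreal_mult_eq_top_iff ennreal_top_mult ennreal_mult_top split: if_splits)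
    then have "A i \<times> B i \<in> null_sets ?M"
      using \<open>A i \<times> B i \<in> sets ?M\<close> by auto
    then have "AE p in ?M. p \<notin> A i \<times> B i" by (rule AE_not_in)
    then show ?thesis
      by eventually_elim (use bad in \<open>simp add: a_def b_def u\<close>)
  qed
  then have all_ab: "AE p in ?M. \<forall>i. a i (fst p) * b i (snd p) = u i p"
    unfolding AE_all_countable by blast
  have cost: "L1_norm M1 (g i) * L1_norm M2 (h i) = (\<integral>p. u i p \<partial>?M)" for i
  proof -
    have "L1_norm M1 (g i) * L1_norm M2 (h i) = L1_norm ?M (tensor (g i) (h i))"
      using integrable_tensor(2)[OF g_int h_int] by simp
    also have "\<dots> = (\<integral>p. u i p \<partial>?M)"
      unfolding L1_norm_def
    proof (rule integral_cong_AE)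
      show "AE p in ?M. norm (tensor (g i) (h i) p) = u i p"
        using ab[of i] by eventually_elim (simp add: T u0)
      show "(\<lambda>p. norm (tensor (g i) (h i) p)) \<in> borel_measurable ?M"
        using T_int[of i] by auto
      show "u i \<in> borel_measurable ?M" using u_int[of i] by auto
    qed
    finally show ?thesis .
  qed
  have S_int: "(\<Sum>i<n. \<integral>p. u i p \<partial>?M) = (\<integral>p. (\<Sum>i<n. u i p) \<partial>?M)" for n
    by (rule Bochner_Integration.integral_sum[symmetric]) (rule u_int)
  \<comment> \<open>The integral is continuous for convergence in mean, so it may be taken
    termwise.\<close>
  have "(\<lambda>i. \<integral>p. u i p \<partial>?M) sums (\<integral>p. f p \<partial>?M)"
    unfolding sums_def S_int
  proof (rule LIM_zero_cancel, rule Lim_null_comparison[OF _ lim], rule always_eventually, rule allI)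
    fix n
    have "(\<integral>p. (\<Sum>i<n. u i p) \<partial>?M) - (\<integral>p. f p \<partial>?M) = - (\<integral>p. f p - (\<Sum>i<n. u i p) \<partial>?M)"
      using f_int u_int by simp
    also have "norm \<dots> \<le> L1_norm ?M (\<lambda>p. f p - (\<Sum>i<n. u i p))"
      unfolding norm_minus_cancel L1_norm_def by (rule integral_norm_bound)
    finally show "norm ((\<integral>p. (\<Sum>i<n. u i p) \<partial>?M) - (\<integral>p. f p \<partial>?M)) \<le> L1_norm ?M (\<lambda>p. f p - (\<Sum>i<n. u i p))" .
  qed
  then have cost_sums: "(\<lambda>i. L1_norm M1 (g i) * L1_norm M2 (h i)) sums (\<integral>p. f p \<partial>?M)"
    by (simp add: cost)
  \<comment> \<open>The list itself gives the upper bound; the product of integrals gives the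
    matching lower bound, since \<open>a i\<close> and \<open>b i\<close> are nonnegative.\<close>
  have proj: "proj_norm M1 M2 (map (\<lambda>i. (g i, h i)) [0..<n]) = (\<Sum>i<n. L1_norm M1 (g i) * L1_norm M2 (h i))" for n
  proof (rule antisym)
    let ?s = "map (\<lambda>i. (g i, h i)) [0..<n]"
    have s: "set ?s \<subseteq> L1_space M1 \<times> L1_space M2"
      using g_int h_int by (auto simp: L1_space_def)
    show "proj_norm M1 M2 ?s \<le> (\<Sum>i<n. L1_norm M1 (g i) * L1_norm M2 (h i))"
      using proj_norm_le_rep_cost[OF s, of ?s]
      by (simp add: same_tensor_def rep_cost_def o_def sum_list_distinct_conv_sum_set atLeast0LessThan)
    have "(\<Sum>i<n. integral\<^sup>L M1 (g i) * integral\<^sup>L M2 (h i)) = of_real (\<Sum>i<n. integral\<^sup>L M1 (a i) * integral\<^sup>L M2 (b i))"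
      using integral_bounded_linear[OF bounded_linear_of_real[where 'a='k] a_int]
        integral_bounded_linear[OF bounded_linear_of_real[where 'a='k] b_int]
      by (simp add: g_def[abs_def] h_def[abs_def])
    moreover have "L1_norm M1 (g i) = integral\<^sup>L M1 (a i)" "L1_norm M2 (h i) = integral\<^sup>L M2 (b i)" for i
      by (simp_all add: L1_norm_def g_def h_def ab0)
    ultimately have "(\<Sum>i<n. integral\<^sup>L M1 (g i) * integral\<^sup>L M2 (h i)) =
        of_real (\<Sum>i<n. L1_norm M1 (g i) * L1_norm M2 (h i))"
      by simp
    moreover have "norm (\<Sum>i<n. integral\<^sup>L M1 (g i) * integral\<^sup>L M2 (h i)) \<le> proj_norm M1 M2 ?s"
      using norm_integral_le_proj_norm[OF s]
      by (simp add: o_def sum_list_distinct_conv_sum_set atLeast0LessThan)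
    ultimately show "(\<Sum>i<n. L1_norm M1 (g i) * L1_norm M2 (h i)) \<le> proj_norm M1 M2 ?s"
      by (simp only: norm_of_real)
  qed
  \<comment> \<open>\<open>of_real\<close> is additive and norm preserving, so convergence of the
    real series carries over to the scalar field.\<close>
  have "L1_norm ?M (\<lambda>p. ?F p - (\<Sum>i<n. tensor (g i) (h i) p)) = L1_norm ?M (\<lambda>p. f p - (\<Sum>i<n. u i p))" for n
    unfolding L1_norm_def
  proof (rule integral_cong_AE)
    show "AE p in ?M. norm (?F p - (\<Sum>i<n. tensor (g i) (h i) p)) = norm (f p - (\<Sum>i<n. u i p))"
      using all_ab
    proof eventually_elim
      case (elim p)
      have "?F p - (\<Sum>i<n. tensor (g i) (h i) p) = of_real (f p - (\<Sum>i<n. u i p))"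
        by (simp only: T elim of_real_diff of_real_sum)
      then show ?case by (simp only: norm_of_real real_norm_def)
    qed
    show "(\<lambda>p. norm (?F p - (\<Sum>i<n. tensor (g i) (h i) p))) \<in> borel_measurable ?M"
      using T_int f_int by (intro borel_measurable_integrable integrable_norm
          Bochner_Integration.integrable_diff Bochner_Integration.integrable_sum) auto
    show "(\<lambda>p. norm (f p - (\<Sum>i<n. u i p))) \<in> borel_measurable ?M"
      using u_int f_int by (intro borel_measurable_integrable integrable_norm
          Bochner_Integration.integrable_diff Bochner_Integration.integrable_sum) auto
  qed
  with lim have "L1_sums ?M (\<lambda>i. tensor (g i) (h i)) ?F"
    using T_int f_int by (simp add: L1_sums_def L1_space_def)
  moreover have "(\<lambda>n. proj_norm M1 M2 (map (\<lambda>i. (g i, h i)) [0..<n]))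
      \<longlonglongrightarrow> (\<Sum>i. L1_norm M1 (g i) * L1_norm M2 (h i))"
    unfolding proj using cost_sums by (intro summable_LIMSEQ) (rule sums_summable)
  ultimately show ?thesis
    unfolding NA_proj_def using g_int h_int sums_summable[OF cost_sums]
    by (auto simp: L1_space_def)
qed

end

theorem theorem4p4:
  fixes \<mu> :: "'a measure" and \<nu> :: "'b measure" and f :: "'a \<times> 'b \<Rightarrow> real"
  assumes "sigma_finite_measure \<mu>" and "sigma_finite_measure \<nu>"
    and "f \<in> L1_space (\<mu> \<Otimes>\<^sub>M \<nu>)"
    and "AE p in \<mu> \<Otimes>\<^sub>M \<nu>. f p \<ge> 0"
  shows "((\<lambda>p. of_real (f p) :: 'k::{real_normed_field, euclidean_space}) \<in> NA_proj \<mu> \<nu> \<longleftrightarrow>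
      (\<exists>(c :: nat \<Rightarrow> real) A B.
         (\<forall>i. c i \<ge> 0 \<and> A i \<in> sets \<mu> \<and> B i \<in> sets \<nu>) \<and>
         L1_sums (\<mu> \<Otimes>\<^sub>M \<nu>)
           (\<lambda>i p. c i * tensor (indicator (A i)) (indicator (B i)) p) f)) \<and>
    ((\<lambda>p. of_real (f p) :: 'k) \<in> NA_proj \<mu> \<nu> \<longleftrightarrow>
      (\<forall>c\<ge>0. \<exists>(A :: nat \<Rightarrow> 'a set) B.
         (\<forall>i. A i \<in> sets \<mu> \<and> B i \<in> sets \<nu>) \<and>
         sym_diff {p \<in> space \<mu> \<times> space \<nu>. f p > c} (\<Union>i. A i \<times> B i)
           \<in> null_sets (\<mu> \<Otimes>\<^sub>M \<nu>)))"
    (is "(?NA \<longleftrightarrow> ?sum) \<and> (?NA \<longleftrightarrow> ?level)")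
proof -
  interpret sigma_finite_measure \<mu> by fact
  interpret \<nu>: sigma_finite_measure \<nu> by fact
  interpret pair_sigma_finite \<mu> \<nu> ..
  have f: "integrable (\<mu> \<Otimes>\<^sub>M \<nu>) f" using assms(3) by (simp add: L1_space_def)
  \<comment> \<open>The implications run in a cycle from \<open>?NA\<close> through
    \<open>rect_sum\<close> and \<open>?sum\<close> back to \<open>?NA\<close>; the level set
    condition is attached at \<open>rect_sum\<close>.\<close>
  have "?NA \<Longrightarrow> rect_sum \<mu> \<nu> (\<lambda>p. ennreal (f p))"
    by (rule NA_proj_imp_rect_sum[OF f assms(4)])
  moreover have "rect_sum \<mu> \<nu> (\<lambda>p. ennreal (f p)) \<Longrightarrow> ?sum"
    by (rule rect_sum_imp_L1_sums[OF f assms(4)])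
  moreover have "?sum \<Longrightarrow> ?NA"
    using rect_sums_imp_NA_proj by blast
  moreover have "rect_sum \<mu> \<nu> (\<lambda>p. ennreal (f p)) \<longleftrightarrow> ?level"
    using f by (intro rect_sum_iff_level_sets assms(4)) auto
  ultimately show ?thesis by argo
qed

end
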